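(* If a C*-algebra $A$ is unital then $\ll_{\mathrm{sm}}^A$ is an $\mathbf{R}$-order in $\mathrm{Id}_A$, $\ll_{\mathrm{sm}}^A\,=\,(\ll_{\mathrm{sm}}^A)^{\triangleright}$ and $\mathfrak{r}_{\mathrm{sm}}(A)=\mathfrak{r}_{\mathrm{sm}}^{\triangleright}(A)$.
   Context: For a C*-algebra $A$, $\mathrm{Id}_A$ is the complete lattice of all closed two-sided ideals of $A$ (called ideals), ordered by inclusion, with supremum $\overline{\sum_{I\in G}I}$ for $G\subseteq\mathrm{Id}_A$. If $A\neq\{0\}$, an ideal $I\in\mathrm{Id}_A$ is small in $A$ if $I+K\neq A$ for all $K\in\mathrm{Id}_A$ with $K\neq A$; if $A=\{0\}$ then $\{0\}$ is a small ideal of $A$. The relation $\ll_{\mathrm{sm}}^A$ in $\mathrm{Id}_A$ is: $I\ll_{\mathrm{sm}}^A J$ iff $I\subseteq J$ and $J/I$ is a small ideal in $A/I$. For a reflexive relation $\ll$ in $\mathrm{Id}_A$ with $I\ll J\Rightarrow I\subseteq J$: $\ll$ is an $\mathbf{H}$-relation if $I\ll J$ and $I\subseteq K$ imply $K\ll J+K$; it is an $\mathbf{R}$-order if it is a transitive $\mathbf{H}$-relation and, for each $I\in\mathrm{Id}_A$, the set $\{J:I\ll J\}$ contains the suprema of all its non-empty subsets. Write $I\ll^{\triangleright}J$ if there is a family of ideals $(I_\lambda)_{1\le\lambda\le\gamma}$ ($\gamma$ an ordinal) with $I_1=I$, $I_\gamma=J$, $I_\lambda\ll I_{\lambda+1}$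 for $\lambda<\gamma$, and $I_\beta=\overline{\bigcup_{\lambda<\beta}I_\lambda}$ for limit ordinals $\beta$. $\ll_{\mathrm{sm}}^A$ is always an $\mathbf{H}$-relation. $\mathfrak{r}_{\mathrm{sm}}^{\triangleright}(A)=\overline{\sum\{J:\{0\}\,(\ll_{\mathrm{sm}}^A)^{\triangleright}\,J\}}$ is the $(\ll_{\mathrm{sm}}^A)^{\triangleright}$-radical; when $\ll_{\mathrm{sm}}^A$ is an $\mathbf{R}$-order, $\mathfrak{r}_{\mathrm{sm}}(A)=\overline{\sum\{J:\{0\}\ll_{\mathrm{sm}}^A J\}}$ is the $\ll_{\mathrm{sm}}^A$-radical. (For an $\mathbf{R}$-order $\ll$ the $\ll$-radical is the unique ideal $\mathfrak r$ with $\{0\}\ll\mathfrak{r}$ such that $\mathfrak r\ll J$ implies $J=\mathfrak r$.) *)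

theory Defs
  imports "HOL-Analysis.Abstract_Metric_Spaces" "HOL-Algebra.QuotRing" "HOL-Algebra.Module"
begin

text \<open>
  C*-algebras are given as records with an explicit carrier, so that a quotient \<open>A/I\<close> is an object
  of the same kind as \<open>A\<close>.  The field \<open>one\<close> inherited from the record of rings carries no meaning
  unless the algebra is unital, i.e. unless \<open>Group.monoid A\<close> is assumed; zero algebras are allowed.
\<close>

record 'a star_algebra = "(complex, 'a) module" +
  star :: "'a \<Rightarrow> 'a"
  nrm :: "'a \<Rightarrow> real"

text \<open>\<^const>\<open>Metric_space\<close> asks for symmetry and nonnegativity outside the carrier as well, hence the
  default value.\<close>

definition alg_dist :: "'a star_algebra \<Rightarrow> 'a \<Rightarrow> 'a \<Rightarrow> real" where
  "alg_dist A x y = (if x \<in> carrier A \<and> y \<in> carrier A then nrm A (x \<ominus>\<^bsub>A\<^esub> y) else 0)"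

definition norm_topology :: "'a star_algebra \<Rightarrow> 'a topology" where
  "norm_topology A = Metric_space.mtopology (carrier A) (alg_dist A)"

locale cstar_algebra = abelian_group A for A :: "'a star_algebra" (structure) +
  assumes mult_closed: "\<lbrakk>x \<in> carrier A; y \<in> carrier A\<rbrakk> \<Longrightarrow> x \<otimes> y \<in> carrier A"
    and mult_assoc: "\<lbrakk>x \<in> carrier A; y \<in> carrier A; z \<in> carrier A\<rbrakk> \<Longrightarrow>
          (x \<otimes> y) \<otimes> z = x \<otimes> (y \<otimes> z)"
    and mult_distrib_right: "\<lbrakk>x \<in> carrier A; y \<in> carrier A; z \<in> carrier A\<rbrakk> \<Longrightarrow>
          (x \<oplus> y) \<otimes> z = x \<otimes> z \<oplus> y \<otimes> z"
    and mult_distrib_left: "\<lbrakk>x \<in> carrier A; y \<in> carrier A; z \<in> carrier A\<rbrakk> \<Longrightarrow>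
          z \<otimes> (x \<oplus> y) = z \<otimes> x \<oplus> z \<otimes> y"
    and scale_closed: "x \<in> carrier A \<Longrightarrow> c \<odot> x \<in> carrier A"
    and scale_add_right: "\<lbrakk>x \<in> carrier A; y \<in> carrier A\<rbrakk> \<Longrightarrow> c \<odot> (x \<oplus> y) = c \<odot> x \<oplus> c \<odot> y"
    and scale_add_left: "x \<in> carrier A \<Longrightarrow> (c + d) \<odot> x = c \<odot> x \<oplus> d \<odot> x"
    and scale_scale: "x \<in> carrier A \<Longrightarrow> (c * d) \<odot> x = c \<odot> (d \<odot> x)"
    and scale_one: "x \<in> carrier A \<Longrightarrow> 1 \<odot> x = x"
    and scale_mult_left: "\<lbrakk>x \<in> carrier A; y \<in> carrier A\<rbrakk> \<Longrightarrow> (c \<odot> x) \<otimes> y = c \<odot> (x \<otimes> y)"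
    and scale_mult_right: "\<lbrakk>x \<in> carrier A; y \<in> carrier A\<rbrakk> \<Longrightarrow> x \<otimes> (c \<odot> y) = c \<odot> (x \<otimes> y)"
    and star_closed: "x \<in> carrier A \<Longrightarrow> star A x \<in> carrier A"
    and star_star: "x \<in> carrier A \<Longrightarrow> star A (star A x) = x"
    and star_add: "\<lbrakk>x \<in> carrier A; y \<in> carrier A\<rbrakk> \<Longrightarrow> star A (x \<oplus> y) = star A x \<oplus> star A y"
    and star_scale: "x \<in> carrier A \<Longrightarrow> star A (c \<odot> x) = cnj c \<odot> star A x"
    and star_mult: "\<lbrakk>x \<in> carrier A; y \<in> carrier A\<rbrakk> \<Longrightarrow> star A (x \<otimes> y) = star A y \<otimes> star A x"
    and nrm_nonneg: "x \<in> carrier A \<Longrightarrow> 0 \<le> nrm A x"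
    and nrm_eq_zero: "x \<in> carrier A \<Longrightarrow> nrm A x = 0 \<longleftrightarrow> x = \<zero>"
    and nrm_triangle: "\<lbrakk>x \<in> carrier A; y \<in> carrier A\<rbrakk> \<Longrightarrow> nrm A (x \<oplus> y) \<le> nrm A x + nrm A y"
    and nrm_scale: "x \<in> carrier A \<Longrightarrow> nrm A (c \<odot> x) = cmod c * nrm A x"
    and nrm_mult: "\<lbrakk>x \<in> carrier A; y \<in> carrier A\<rbrakk> \<Longrightarrow> nrm A (x \<otimes> y) \<le> nrm A x * nrm A y"
    and cstar_identity: "x \<in> carrier A \<Longrightarrow> nrm A (star A x \<otimes> x) = (nrm A x)\<^sup>2"
    and complete: "Metric_space.mcomplete (carrier A) (alg_dist A)"

definition closed_ideal :: "'a set \<Rightarrow> 'a star_algebra \<Rightarrow> bool" where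
  "closed_ideal I A \<longleftrightarrow>
     additive_subgroup I A \<and>
     (\<forall>c. \<forall>x\<in>I. c \<odot>\<^bsub>A\<^esub> x \<in> I) \<and>
     (\<forall>x\<in>I. \<forall>a\<in>carrier A. a \<otimes>\<^bsub>A\<^esub> x \<in> I \<and> x \<otimes>\<^bsub>A\<^esub> a \<in> I) \<and>
     closedin (norm_topology A) I"

definition closed_ideals :: "'a star_algebra \<Rightarrow> 'a set set" where
  "closed_ideals A = {I. closed_ideal I A}"

definition algebraic_sum :: "'a star_algebra \<Rightarrow> 'a set set \<Rightarrow> 'a set" where
  "algebraic_sum A G =
     {\<Oplus>\<^bsub>A\<^esub>I\<in>F. f I | F f. finite F \<and> F \<subseteq> G \<and> (\<forall>I\<in>F. f I \<in> I)}"

definition ideal_sup :: "'a star_algebra \<Rightarrow> 'a set set \<Rightarrow> 'a set" where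
  "ideal_sup A G = norm_topology A closure_of algebraic_sum A G"

text \<open>The quotient is the one of \<^const>\<open>FactRing\<close>, with the induced scalar multiplication and
  involution and the quotient norm.\<close>

definition quotient_algebra :: "'a star_algebra \<Rightarrow> 'a set \<Rightarrow> 'a set star_algebra" where
  "quotient_algebra A I =
     \<lparr>carrier = a_rcosets\<^bsub>A\<^esub> I,
      mult = rcoset_mult A I,
      one = I +>\<^bsub>A\<^esub> \<one>\<^bsub>A\<^esub>,
      zero = I,
      add = set_add A,
      smult = (\<lambda>c X. \<Union>x\<in>X. I +>\<^bsub>A\<^esub> (c \<odot>\<^bsub>A\<^esub> x)),
      star = (\<lambda>X. \<Union>x\<in>X. I +>\<^bsub>A\<^esub> star A x),
      nrm = (\<lambda>X. Inf (nrm A ` X))\<rparr>"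

definition small_ideal :: "'a set \<Rightarrow> 'a star_algebra \<Rightarrow> bool" where
  "small_ideal I A \<longleftrightarrow>
     I \<in> closed_ideals A \<and>
     (if carrier A = {\<zero>\<^bsub>A\<^esub>} then I = {\<zero>\<^bsub>A\<^esub>}
      else \<forall>K\<in>closed_ideals A. K \<noteq> carrier A \<longrightarrow> I <+>\<^bsub>A\<^esub> K \<noteq> carrier A)"

definition sm_rel :: "'a star_algebra \<Rightarrow> 'a set rel" where
  "sm_rel A =
     {(I, J). I \<in> closed_ideals A \<and> J \<in> closed_ideals A \<and> I \<subseteq> J \<and>
        small_ideal ((\<lambda>x. I +>\<^bsub>A\<^esub> x) ` J) (quotient_algebra A I)}"

definition H_relation :: "'a star_algebra \<Rightarrow> 'a set rel \<Rightarrow> bool" where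
  "H_relation A R \<longleftrightarrow>
     R \<subseteq> closed_ideals A \<times> closed_ideals A \<and> refl_on (closed_ideals A) R \<and> (\<forall>(I, J)\<in>R. I \<subseteq> J) \<and>
     (\<forall>(I, J)\<in>R. \<forall>K\<in>closed_ideals A. I \<subseteq> K \<longrightarrow> (K, J <+>\<^bsub>A\<^esub> K) \<in> R)"

definition R_order :: "'a star_algebra \<Rightarrow> 'a set rel \<Rightarrow> bool" where
  "R_order A R \<longleftrightarrow>
     H_relation A R \<and> trans R \<and>
     (\<forall>I\<in>closed_ideals A. \<forall>G. G \<noteq> {} \<and> G \<subseteq> {J. (I, J) \<in> R} \<longrightarrow> ideal_sup A G \<in> {J. (I, J) \<in> R})"

text \<open>
  An ordinal interval \<open>[1, \<gamma>]\<close> is a well-order \<open>r\<close> with a greatest element.  In it, \<open>b\<close> is the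
  successor of \<open>a\<close> iff the strict predecessors of \<open>b\<close> are the elements below or equal to \<open>a\<close>, and \<open>b\<close>
  is a limit iff it is neither the least element nor a successor.
\<close>

definition transfinite_family ::
    "'a star_algebra \<Rightarrow> 'a set rel \<Rightarrow> 'i rel \<Rightarrow> ('i \<Rightarrow> 'a set) \<Rightarrow> 'a set \<Rightarrow> 'a set \<Rightarrow> bool" where
  "transfinite_family A R r F I J \<longleftrightarrow>
     Well_order r \<and>
     (\<forall>a\<in>Field r. F a \<in> closed_ideals A) \<and>
     (\<exists>a\<in>Field r. underS r a = {} \<and> F a = I) \<and>
     (\<exists>c\<in>Field r. under r c = Field r \<and> F c = J) \<and>
     (\<forall>a\<in>Field r. \<forall>b\<in>Field r. underS r b = under r a \<longrightarrow> (F a, F b) \<in> R) \<and>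
     (\<forall>b\<in>Field r. underS r b \<noteq> {} \<and> (\<forall>a\<in>Field r. underS r b \<noteq> under r a) \<longrightarrow>
        F b = norm_topology A closure_of (\<Union>a\<in>underS r b. F a))"

text \<open>
  One cannot quantify over all ordinals inside a formula; here the ordinals are well-orders on sets
  of subsets of the algebra.  Lemma \<open>transfinite_closureI\<close> below shows that families indexed by
  well-orders on arbitrary types give nothing more.
\<close>

definition transfinite_closure :: "'a star_algebra \<Rightarrow> 'a set rel \<Rightarrow> 'a set rel" where
  "transfinite_closure A R =
     {(I, J). \<exists>(r :: 'a set rel) F. transfinite_family A R r F I J}"

definition radical :: "'a star_algebra \<Rightarrow> 'a set rel \<Rightarrow> 'a set" where
  "radical A R = ideal_sup A {J. ({\<zero>\<^bsub>A\<^esub>}, J) \<in> R}"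

sublocale cstar_algebra \<subseteq> Metric_space "carrier A" "alg_dist A"
proof
  show "0 \<le> alg_dist A x y" for x y
    by (simp add: alg_dist_def nrm_nonneg)
  show "alg_dist A x y = alg_dist A y x" for x y
  proof (cases "x \<in> carrier A \<and> y \<in> carrier A")
    case True
    then have c: "x \<ominus> y \<in> carrier A" by simp
    have z: "0 \<odot> u = \<zero>" if "u \<in> carrier A" for u
      using nrm_scale[OF that, of 0] nrm_eq_zero[of "0 \<odot> u"] that scale_closed by simp
    have "(-1) \<odot> (x \<ominus> y) \<oplus> (x \<ominus> y) = \<zero>"
      using scale_add_left[OF c, of "-1" 1] scale_one[OF c] z[OF c] by simp
    then have "(-1) \<odot> (x \<ominus> y) = \<ominus> (x \<ominus> y)"
      using c scale_closed minus_equality by metis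
    also have "\<dots> = y \<ominus> x"
      using True by (simp add: a_minus_def minus_add a_comm)
    finally have "nrm A (y \<ominus> x) = nrm A (x \<ominus> y)"
      using nrm_scale[OF c, of "-1"] by simp
    then show ?thesis by (simp add: alg_dist_def)
  qed (auto simp: alg_dist_def)
  show "alg_dist A x y = 0 \<longleftrightarrow> x = y" if "x \<in> carrier A" "y \<in> carrier A" for x y
  proof -
    have "x \<ominus> y = \<zero> \<longleftrightarrow> x = y"
      using that by (metis a_minus_def a_inv_closed minus_equality minus_minus r_neg)
    then show ?thesis
      using that nrm_eq_zero[of "x \<ominus> y"] by (simp add: alg_dist_def)
  qed
  show "alg_dist A x z \<le> alg_dist A x y + alg_dist A y z"
    if "x \<in> carrier A" "y \<in> carrier A" "z \<in> carrier A" for x y z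
  proof -
    have "x \<ominus> z = (x \<ominus> y) \<oplus> (y \<ominus> z)"
      using that by (metis a_minus_def a_assoc a_inv_closed l_neg l_zero minus_closed)
    then show ?thesis
      using nrm_triangle[of "x \<ominus> y" "y \<ominus> z"] that by (simp add: alg_dist_def)
  qed
qed

lemma (in cstar_algebra) transfinite_closureI:
  fixes r :: "'i rel"
  assumes R: "\<And>X Y. (X, Y) \<in> R \<Longrightarrow> X \<subseteq> Y"
    and fam: "transfinite_family A R r F I J"
  shows "(I, J) \<in> transfinite_closure A R"
proof -
  have cl: "topspace (norm_topology A) = carrier A"
    by (simp add: norm_topology_def)
  have wo: "Well_order r"
    and FI: "\<And>a. a \<in> Field r \<Longrightarrow> F a \<in> closed_ideals A"
    and suc: "\<And>a b. \<lbrakk>a \<in> Field r; b \<in> Field r; underS r b = under r a\<rbrakk> \<Longrightarrow> (F a, F b) \<in> R"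
    and lim: "\<And>b. \<lbrakk>b \<in> Field r; underS r b \<noteq> {}; \<And>a. a \<in> Field r \<Longrightarrow> underS r b \<noteq> under r a\<rbrakk> \<Longrightarrow>
        F b = norm_topology A closure_of (\<Union>a\<in>underS r b. F a)"
    using fam unfolding transfinite_family_def by blast+
  obtain z g where z: "z \<in> Field r" "underS r z = {}" "F z = I"
    and g: "g \<in> Field r" "under r g = Field r" "F g = J"
    using fam unfolding transfinite_family_def by blast
  have closed: "closedin (norm_topology A) (F a)" and sub: "F a \<subseteq> carrier A" if "a \<in> Field r" for a
    using FI[OF that] closedin_subset cl unfolding closed_ideals_def closed_ideal_def by auto
  have "Refl r" "Total r" "antisym r" and wf: "wf (r - Id)"
    using wo by (simp_all add: order_on_defs well_order_on_def)
  then have refl: "a \<in> Field r \<Longrightarrow> (a, a) \<in> r"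
    and tot: "\<lbrakk>a \<in> Field r; b \<in> Field r\<rbrakk> \<Longrightarrow> (a, b) \<in> r \<or> (b, a) \<in> r"
    and antisym: "\<lbrakk>(a, b) \<in> r; (b, a) \<in> r\<rbrakk> \<Longrightarrow> a = b" for a b
    by (metis refl_onD, metis refl_onD total_on_def, metis antisymD)
  have mono: "(a, b) \<in> r \<Longrightarrow> F a \<subseteq> F b" for a b
  proof (induction b arbitrary: a rule: wf_induct_rule[OF wf])
    case (1 b)
    have fld: "a \<in> Field r" "b \<in> Field r" using 1(2) by (auto simp: Field_def)
    show ?case
    proof (cases "a = b")
      case False
      then have a: "a \<in> underS r b" using 1(2) by (simp add: underS_def)
      show ?thesis
      proof (cases "\<exists>c\<in>Field r. underS r b = under r c")
        case True
        then obtain c where c: "c \<in> Field r" "underS r b = under r c" by blast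
        have "(a, c) \<in> r" using a c by (simp add: under_def)
        moreover have "(c, b) \<in> r - Id"
          using c refl[of c] unfolding under_def underS_def by blast
        ultimately have "F a \<subseteq> F c" using 1(1) by blast
        also have "\<dots> \<subseteq> F b" using R suc c fld by blast
        finally show ?thesis .
      next
        case False
        then have "F b = norm_topology A closure_of (\<Union>a\<in>underS r b. F a)"
          using lim fld a by blast
        moreover have "F a \<subseteq> norm_topology A closure_of F a"
          using closure_of_subset sub[OF fld(1)] cl by metis
        moreover have "\<dots> \<subseteq> norm_topology A closure_of (\<Union>a\<in>underS r b. F a)"
          using a by (intro closure_of_mono) blast
        ultimately show ?thesis by blast
      qed
    qed simp
  qed
  define S where "S = F ` Field r"
  define q where "q = {(X, Y). X \<in> S \<and> Y \<in> S \<and> X \<subseteq> Y}"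
  have Fq: "Field q = S" by (auto simp: q_def Field_def)
  have least: "\<exists>b\<in>Field r. P b \<and> (\<forall>c. (c, b) \<in> r \<longrightarrow> c \<noteq> b \<longrightarrow> \<not> P c)"
    if "a \<in> Field r" "P a" for P a
  proof -
    have "a \<in> {b \<in> Field r. P b}" using that by simp
    from wfE_min[OF wf this] obtain b where b: "b \<in> {b \<in> Field r. P b}"
      "\<And>c. (c, b) \<in> r - Id \<Longrightarrow> c \<notin> {b \<in> Field r. P b}" by metis
    have "\<not> P c" if "(c, b) \<in> r" "c \<noteq> b" for c
      using b(2)[of c] that FieldI1[of c b r] by simp
    then show ?thesis using b(1) by blast
  qed
  have first: "\<exists>b\<in>Field r. F b = Y \<and> F ` underS r b = underS q Y" if Y: "Y \<in> S" for Y
  proof -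
    obtain a where "a \<in> Field r" "F a = Y" using Y by (auto simp: S_def)
    from least[of a "\<lambda>b. F b = Y", OF this] obtain b where b: "b \<in> Field r" "F b = Y"
      and min: "\<And>c. \<lbrakk>(c, b) \<in> r; c \<noteq> b\<rbrakk> \<Longrightarrow> F c \<noteq> Y" by blast
    have "F ` underS r b \<subseteq> underS q Y"
    proof
      fix X assume "X \<in> F ` underS r b"
      then obtain c where c: "X = F c" "c \<noteq> b" "(c, b) \<in> r" by (auto simp: underS_def)
      then have "F c \<noteq> Y" "F c \<subseteq> F b" "c \<in> Field r"
        using min mono by (auto simp: Field_def)
      then show "X \<in> underS q Y" using b c by (auto simp: underS_def q_def S_def)
    qed
    moreover have "underS q Y \<subseteq> F ` underS r b"
    proof
      fix X assume "X \<in> underS q Y"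
      then obtain c where c: "c \<in> Field r" "F c = X" "X \<subseteq> Y" "X \<noteq> Y"
        by (auto simp: underS_def q_def S_def)
      then have "(b, c) \<notin> r" using mono[of b c] b by blast
      then have "(c, b) \<in> r" "c \<noteq> b" using tot[of b c] b c by auto
      then show "X \<in> F ` underS r b" using c by (auto simp: underS_def)
    qed
    ultimately show ?thesis using b by blast
  qed
  have pred: "underS q (F b) = under q (F a)"
    if a: "a \<in> Field r" "b \<in> Field r" "underS r b = under r a" "F ` underS r b = underS q (F b)"
    for a b
  proof -
    have "F ` under r a = under q (F a)" if ne: "F a \<noteq> F b"
    proof
      show "F ` under r a \<subseteq> under q (F a)"
        using mono by (auto simp: under_def q_def S_def Field_def)
      have "F a \<subseteq> F b" using R suc a by blast
      then have "under q (F a) \<subseteq> underS q (F b)"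
        using ne a(2) by (auto simp: under_def underS_def q_def S_def)
      then show "under q (F a) \<subseteq> F ` under r a" using a by simp
    qed
    moreover have "F a \<noteq> F b"
    proof -
      have "a \<in> underS r b" unfolding a(3) using a refl by (simp add: under_def)
      then have "F a \<in> underS q (F b)" unfolding a(4)[symmetric] by (rule imageI)
      then show ?thesis by (simp add: underS_def)
    qed
    ultimately show ?thesis using a by simp
  qed
  have c1: "Well_order q"
  proof -
    have "wf (q - Id)"
    proof (rule wfI_min)
      fix X Q assume X: "X \<in> (Q :: 'a set set)"
      show "\<exists>Z\<in>Q. \<forall>Y. (Y, Z) \<in> q - Id \<longrightarrow> Y \<notin> Q"
      proof (cases "Q \<inter> S = {}")
        case True
        then show ?thesis using X by (auto simp: q_def)
      next
        case False
        then obtain a where "a \<in> Field r" "F a \<in> Q" by (auto simp: S_def)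
        from least[of a "\<lambda>b. F b \<in> Q", OF this] obtain b where b: "b \<in> Field r" "F b \<in> Q"
          and min: "\<And>c. \<lbrakk>(c, b) \<in> r; c \<noteq> b\<rbrakk> \<Longrightarrow> F c \<notin> Q" by blast
        have "Y \<notin> Q" if Y: "(Y, F b) \<in> q - Id" for Y
        proof -
          obtain c where c: "c \<in> Field r" "F c = Y" "Y \<subseteq> F b" "Y \<noteq> F b"
            using Y by (auto simp: q_def S_def)
          then have "(b, c) \<notin> r" using mono[of b c] by blast
          then have "(c, b) \<in> r" "c \<noteq> b" using tot[of b c] b c by auto
          then show ?thesis using min c by blast
        qed
        then show ?thesis using b by blast
      qed
    qed
    moreover have "X \<subseteq> Y \<or> Y \<subseteq> X" if "X \<in> S" "Y \<in> S" for X Y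
      using that tot mono unfolding S_def by blast
    ultimately show ?thesis
      unfolding well_order_on_def order_on_defs Fq
      by (auto simp: q_def refl_on_def trans_def antisym_def total_on_def)
  qed
  have c2: "\<forall>X\<in>Field q. X \<in> closed_ideals A"
    using FI by (auto simp: Fq S_def)
  have c3: "I \<in> Field q \<and> underS q I = {}"
  proof -
    have "I \<subseteq> F a" if "a \<in> Field r" for a
    proof -
      have "(z, a) \<in> r" using tot[of z a] z that refl[of a] by (cases "a = z") (auto simp: underS_def)
      then show ?thesis using mono z by blast
    qed
    then show ?thesis unfolding Fq using z by (auto simp: underS_def q_def S_def)
  qed
  have c4: "J \<in> Field q \<and> under q J = Field q"
  proof -
    have "F a \<subseteq> J" if "a \<in> Field r" for a
      using mono[of a g] g that by (auto simp: under_def)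
    then show ?thesis unfolding Fq using g by (auto simp: under_def q_def S_def)
  qed
  have c5: "(X, Y) \<in> R" if X: "X \<in> Field q" and Y: "Y \<in> Field q" and XY: "underS q Y = under q X" for X Y
  proof -
    obtain b where b: "b \<in> Field r" "F b = Y" "F ` underS r b = underS q Y"
      using first Y Fq by blast
    have Xin: "X \<in> underS q Y" unfolding XY using X[unfolded Fq] by (simp add: under_def q_def)
    show ?thesis
    proof (cases "\<exists>a\<in>Field r. underS r b = under r a")
      case True
      then obtain a where a: "a \<in> Field r" "underS r b = under r a" by blast
      then have "under q X = under q (F a)" using pred[of a b] b XY by simp
      moreover have "F a \<in> S" using a by (simp add: S_def)
      ultimately have "X = F a" using X unfolding Fq under_def q_def by blast
      then show ?thesis using suc a b by blast
    next
      case False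
      have "underS r b \<noteq> {}" using b Xin by auto
      then have "F b = norm_topology A closure_of (\<Union>a\<in>underS r b. F a)"
        using lim b False by blast
      moreover have "(\<Union>a\<in>underS r b. F a) \<subseteq> X"
        using b XY by (auto simp: under_def q_def)
      moreover have "closedin (norm_topology A) X"
        using X closed by (auto simp: Fq S_def)
      ultimately have "Y \<subseteq> X" using b closure_of_minimal by metis
      then show ?thesis using Xin by (auto simp: underS_def q_def)
    qed
  qed
  have c6: "Y = norm_topology A closure_of (\<Union>X\<in>underS q Y. X)"
    if Y: "Y \<in> Field q" "underS q Y \<noteq> {}" "\<And>X. X \<in> Field q \<Longrightarrow> underS q Y \<noteq> under q X" for Y
  proof -
    obtain b where b: "b \<in> Field r" "F b = Y" "F ` underS r b = underS q Y"
      using first Y Fq by blast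
    have "underS r b \<noteq> under r a" if a: "a \<in> Field r" for a
    proof
      assume "underS r b = under r a"
      then have "underS q (F b) = under q (F a)" using pred[of a b] a b by metis
      moreover have "F a \<in> Field q" unfolding Fq S_def using a by blast
      ultimately show False using Y(3)[of "F a"] b(2) by metis
    qed
    moreover have "underS r b \<noteq> {}" using b(3) Y(2) by auto
    ultimately have "F b = norm_topology A closure_of (\<Union>a\<in>underS r b. F a)"
      using lim b(1) by metis
    then show ?thesis using b by simp
  qed
  have "transfinite_family A R q (\<lambda>X. X) I J"
    unfolding transfinite_family_def
  proof (intro conjI ballI impI)
    show "\<exists>X\<in>Field q. underS q X = {} \<and> X = I" using c3 by blast
    show "\<exists>X\<in>Field q. under q X = Field q \<and> X = J" using c4 by blast
  qed (use c1 c2 c5 c6 in simp_all)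
  then show ?thesis unfolding transfinite_closure_def by blast
qed

end

theory Submission
  imports "HOL-Analysis.Urysohn" Defs
begin

text \<open>
  Write \<open>I \<ll> J\<close> for \<open>(I, J) \<in> sm_rel A\<close>.  Closed ideals of \<open>A/I\<close> are the images of the closed ideals
  of \<open>A\<close> that contain \<open>I\<close>, so \<open>I \<ll> J\<close> can be read off in \<open>A\<close> itself: \<open>I \<subseteq> J\<close>, and a closed ideal
  \<open>L \<supseteq> I\<close> with \<open>J + L = A\<close> must be \<open>A\<close> (\<open>sm_rel_iff\<close>).

  In this form transitivity is immediate: if \<open>I \<ll> J \<ll> K\<close>, \<open>I \<subseteq> L\<close> and \<open>K + L = A\<close>, then \<open>J + L\<close> is a
  closed ideal above \<open>J\<close> whose sum with \<open>K\<close> is \<open>A\<close>, so \<open>J + L = A\<close> and hence \<open>L = A\<close>.  The same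
  elimination, one summand after the other, removes a finite sum of ideals that are \<open>\<ll>\<close>-above \<open>I\<close>
  (\<open>sm_rel_finite_sum\<close>).  The unit serves to reduce arbitrary suprema to finite sums.  If
  \<open>S + L = A\<close> for the closure \<open>S\<close> of the sum of a family, write \<open>1 = y + l\<close> with \<open>y \<in> S\<close>, \<open>l \<in> L\<close>, and
  replace \<open>y\<close> by some \<open>s\<close> with \<open>\<parallel>y - s\<parallel> < 1\<close> in a finite sum of members of the family; \<open>s + l\<close> is still
  invertible (\<open>sm_rel_ideal_sup\<close>).  This makes \<open>\<ll>\<close> an \<open>R\<close>-order.

  An \<open>R\<close>-order coincides with its transfinite closure by transfinite induction along a chain that
  starts at \<open>I\<close>: successor steps are transitivity, and at a limit the closure of the union is the
  supremum of ideals already known to be \<open>\<ll>\<close>-above \<open>I\<close>.  Equality of the radicals follows.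

  Adding ideals in this way requires that \<open>J + L\<close> is closed (\<open>add_closed_ideals\<close>).  The reason is
  that closed ideals of a C*-algebra contain bounded local right units
  (\<open>approximate_right_unit\<close>).  They are built here without spectral theory: for self-adjoint \<open>h\<close>
  and \<open>s > 0\<close>, \<open>h + is\<close> is invertible and its Cayley transform is an isometry, which gives the
  norm bounds for \<open>u = h\<^sup>2 (h\<^sup>2 + s\<^sup>2)\<^sup>-\<^sup>1\<close>.
\<close>

text \<open>In what follows \<open><+>\<close> always denotes the sum of two subsets of an algebra.\<close>

no_notation Sum_Type.Plus (infixr \<open><+>\<close> 65)

section \<open>Norm estimates and the Neumann series\<close>

locale unital_cstar_algebra = cstar_algebra A + monoid A for A (structure)

sublocale unital_cstar_algebra \<subseteq> ring A
  by unfold_locales (simp_all add: mult_distrib_right mult_distrib_left)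

context unital_cstar_algebra
begin

lemma diff_add_left:
  "\<lbrakk>x \<in> carrier A; y \<in> carrier A; z \<in> carrier A\<rbrakk> \<Longrightarrow> (x \<oplus> y) \<ominus> (x \<oplus> z) = y \<ominus> z"
  by algebra

lemma scale_zero: "x \<in> carrier A \<Longrightarrow> 0 \<odot> x = \<zero>"
  using nrm_scale[of x 0] nrm_eq_zero[of "0 \<odot> x"] scale_closed[of x 0] by simp

lemma scale_minus_one:
  assumes "x \<in> carrier A"
  shows "(-1) \<odot> x = \<ominus> x"
  using scale_add_left[OF assms, of "-1" 1] assms
  by (metis add.left_inverse minus_equality scale_closed scale_one scale_zero)

lemma nrm_minus: "x \<in> carrier A \<Longrightarrow> nrm A (\<ominus> x) = nrm A x"
  using nrm_scale[of x "-1"] by (simp add: scale_minus_one)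

lemma nrm_diff_triangle:
  "\<lbrakk>x \<in> carrier A; y \<in> carrier A\<rbrakk> \<Longrightarrow> nrm A (x \<ominus> y) \<le> nrm A x + nrm A y"
  using nrm_triangle[of x "\<ominus> y"] by (simp add: nrm_minus minus_eq)

lemma nrm_diff_commute:
  "\<lbrakk>x \<in> carrier A; y \<in> carrier A\<rbrakk> \<Longrightarrow> nrm A (x \<ominus> y) = nrm A (y \<ominus> x)"
  using commute[of x y] by (simp add: alg_dist_def)

lemma nrm_diff_trans:
  "\<lbrakk>x \<in> carrier A; y \<in> carrier A; z \<in> carrier A\<rbrakk> \<Longrightarrow>
    nrm A (x \<ominus> z) \<le> nrm A (x \<ominus> y) + nrm A (y \<ominus> z)"
  using triangle[of x y z] by (simp add: alg_dist_def)

lemma star_one: "star A \<one> = \<one>"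
  by (metis l_one one_closed r_one star_closed star_mult star_star)

text \<open>The C*-identity gives \<open>\<parallel>1\<parallel>\<^sup>2 = \<parallel>1\<parallel>\<close>, so \<open>\<parallel>1\<parallel>\<close> is \<open>0\<close> or \<open>1\<close>; the value \<open>0\<close> belongs to the zero
  algebra, hence the inequality.\<close>

lemma nrm_le_one_of_isometry:
  assumes "u \<in> carrier A" "star A u \<otimes> u = \<one>"
  shows "nrm A u \<le> 1"
proof -
  have "(nrm A \<one>)\<^sup>2 = nrm A \<one>"
    using cstar_identity[OF one_closed] by (simp add: star_one)
  then have "(nrm A u)\<^sup>2 \<le> 1"
    using cstar_identity[OF assms(1)] assms(2) by (auto simp: power2_eq_square)
  then show ?thesis
    using nrm_nonneg[OF assms(1)] by (simp add: power2_le_iff_abs_le abs_square_le_1)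
qed

lemma nrm_one_le: "nrm A \<one> \<le> 1"
  using nrm_le_one_of_isometry[of \<one>] by (simp add: star_one)

text \<open>The C*-identity bounds \<open>\<parallel>y\<parallel>\<^sup>2\<close> by \<open>\<parallel>y\<^sup>*\<parallel> \<parallel>y\<parallel>\<close>; this is used for \<open>x\<close> and for \<open>x\<^sup>*\<close>.\<close>

lemma nrm_star:
  assumes "x \<in> carrier A"
  shows "nrm A (star A x) = nrm A x"
proof -
  have le: "nrm A y \<le> nrm A (star A y)" if "y \<in> carrier A" for y
  proof (cases "nrm A y = 0")
    case False
    have "nrm A y * nrm A y \<le> nrm A (star A y) * nrm A y"
      using cstar_identity[OF that] nrm_mult[of "star A y" y] that
      by (simp add: star_closed power2_eq_square)
    then show ?thesis
      using False nrm_nonneg[OF that] by simp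
  qed (use that in \<open>simp add: nrm_nonneg star_closed\<close>)
  show ?thesis
    using le[of x] le[of "star A x"] assms by (simp add: star_closed star_star)
qed

text \<open>The maps \<open>y \<mapsto> 1 + xy\<close> and \<open>y \<mapsto> 1 + yx\<close> are contractions, and their fixed points are a right and a
  left inverse of \<open>1 - x\<close>.\<close>

lemma Units_one_minus:
  assumes x: "x \<in> carrier A" and lt: "nrm A x < 1"
  shows "\<one> \<ominus> x \<in> Units A"
proof -
  have contraction: "\<exists>y\<in>carrier A. y = \<one> \<oplus> T y"
    if T: "\<And>y. y \<in> carrier A \<Longrightarrow> T y \<in> carrier A"
      "\<And>y z. \<lbrakk>y \<in> carrier A; z \<in> carrier A\<rbrakk> \<Longrightarrow> nrm A (T y \<ominus> T z) \<le> nrm A x * nrm A (y \<ominus> z)" for T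
  proof -
    obtain y where "y \<in> carrier A" "\<one> \<oplus> T y = y"
    proof (rule Banach_fixedpoint_thm[OF complete])
      show "carrier A \<noteq> {}" "(\<lambda>y. \<one> \<oplus> T y) \<in> carrier A \<rightarrow> carrier A" "nrm A x < 1"
        using T lt by auto
      fix y z assume yz: "y \<in> carrier A" "z \<in> carrier A"
      then have "(\<one> \<oplus> T y) \<ominus> (\<one> \<oplus> T z) = T y \<ominus> T z"
        using T(1) one_closed diff_add_left by simp
      then show "alg_dist A (\<one> \<oplus> T y) (\<one> \<oplus> T z) \<le> nrm A x * alg_dist A y z"
        using T yz by (simp add: alg_dist_def)
    qed
    then show ?thesis by metis
  qed
  have "\<exists>y\<in>carrier A. y = \<one> \<oplus> x \<otimes> y"
  proof (rule contraction)
    show "nrm A (x \<otimes> y \<ominus> x \<otimes> z) \<le> nrm A x * nrm A (y \<ominus> z)"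
      if "y \<in> carrier A" "z \<in> carrier A" for y z
      using nrm_mult[of x "y \<ominus> z"] x that by (simp add: minus_eq r_distr r_minus)
  qed (use x in simp)
  then obtain y where y: "y \<in> carrier A" "y = \<one> \<oplus> x \<otimes> y" by blast
  have "\<exists>y\<in>carrier A. y = \<one> \<oplus> y \<otimes> x"
  proof (rule contraction)
    show "nrm A (y \<otimes> x \<ominus> z \<otimes> x) \<le> nrm A x * nrm A (y \<ominus> z)"
      if "y \<in> carrier A" "z \<in> carrier A" for y z
      using nrm_mult[of "y \<ominus> z" x] x that by (simp add: minus_eq l_distr l_minus mult.commute)
  qed (use x in simp)
  then obtain z where z: "z \<in> carrier A" "z = \<one> \<oplus> z \<otimes> x" by blast
  have "(\<one> \<ominus> x) \<otimes> y = y \<ominus> x \<otimes> y" "z \<otimes> (\<one> \<ominus> x) = z \<ominus> z \<otimes> x"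
    using x y(1) z(1) by (simp_all add: minus_eq l_distr r_distr l_minus r_minus)
  moreover have "y \<ominus> x \<otimes> y = \<one>" "z \<ominus> z \<otimes> x = \<one>"
    using x y z by (metis a_minus_def add.inv_solve_right m_closed one_closed)+
  ultimately have yz: "(\<one> \<ominus> x) \<otimes> y = \<one>" "z \<otimes> (\<one> \<ominus> x) = \<one>"
    by simp_all
  then have "z = y"
    using inv_unique[of z "\<one> \<ominus> x" y] x y(1) z(1) by simp
  with yz show ?thesis
    unfolding Units_def using x y(1) by auto
qed

text \<open>Because \<open>a\<^sup>-\<^sup>1 b = 1 - a\<^sup>-\<^sup>1 (a - b)\<close>.\<close>

lemma Units_perturb:
  assumes a: "a \<in> Units A" and b: "b \<in> carrier A" and lt: "nrm A (inv a) * nrm A (a \<ominus> b) < 1"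
  shows "b \<in> Units A"
proof -
  have ca: "a \<in> carrier A" "inv a \<in> carrier A" using a by auto
  have "inv a \<otimes> (a \<ominus> b) \<in> carrier A" using ca b by simp
  moreover have "nrm A (inv a \<otimes> (a \<ominus> b)) < 1"
    using nrm_mult[of "inv a" "a \<ominus> b"] ca b lt by simp
  ultimately have "\<one> \<ominus> inv a \<otimes> (a \<ominus> b) \<in> Units A"
    by (rule Units_one_minus)
  moreover have "\<one> \<ominus> inv a \<otimes> (a \<ominus> b) = inv a \<otimes> b"
    using ca b a by (simp add: minus_eq r_distr r_minus minus_add r_neg2)
  ultimately have "a \<otimes> (inv a \<otimes> b) \<in> Units A"
    using a by simp
  then show ?thesis
    using a ca b by (simp add: m_assoc[symmetric])
qed

section \<open>Resolvents of self-adjoint elements\<close>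

lemma scale_one_mult:
  "x \<in> carrier A \<Longrightarrow> (c \<odot> \<one>) \<otimes> x = c \<odot> x"
  "x \<in> carrier A \<Longrightarrow> x \<otimes> (c \<odot> \<one>) = c \<odot> x"
  by (simp_all add: scale_mult_left scale_mult_right)

lemma nrm_scale_one_le: "nrm A (c \<odot> \<one>) \<le> cmod c"
  using mult_left_mono[OF nrm_one_le, of "cmod c"] by (simp add: nrm_scale)

text \<open>Put \<open>a = h + is\<close> and \<open>r = a\<^sup>-\<^sup>1\<close>.  The Cayley transform \<open>u = (h - is) r\<close> satisfies \<open>u\<^sup>* u = 1\<close>, so
  \<open>\<parallel>u\<parallel> \<le> 1\<close>.  Both bounds follow from \<open>2is r = 1 - u\<close> and \<open>2 h r = 1 + u\<close>.\<close>

lemma self_adjoint_resolvent_bounds: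
  fixes s :: real
  assumes h: "h \<in> carrier A" "star A h = h" and s: "0 < s"
    and unit: "h \<oplus> (\<i> * s) \<odot> \<one> \<in> Units A"
  defines "r \<equiv> inv (h \<oplus> (\<i> * s) \<odot> \<one>)"
  shows "nrm A r \<le> 1 / s" and "nrm A (h \<otimes> r) \<le> 1"
proof -
  define e where "e = (\<i> * s) \<odot> \<one>"
  define a where "a = h \<oplus> e"
  define b where "b = h \<ominus> e"
  have e: "e \<in> carrier A" "star A e = \<ominus> e" and eh: "h \<otimes> e = e \<otimes> h"
    using h by (simp_all add: e_def scale_closed star_scale star_one scale_one_mult
        scale_minus_one[symmetric] scale_scale[symmetric])
  have c: "a \<in> carrier A" "b \<in> carrier A" "r \<in> carrier A"
    and ar: "a \<otimes> r = \<one>" and ra: "r \<otimes> a = \<one>"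
    using unit h e by (auto simp: a_def b_def r_def e_def)
  have star_a: "star A a = b" and star_b: "star A b = a"
    using h e by (simp_all add: a_def b_def star_add minus_eq
        star_star[OF e(1), unfolded e(2)])
  have ab: "a \<otimes> b = b \<otimes> a"
    using h(1) e(1) eh by (simp add: a_def b_def minus_eq l_distr r_distr l_minus r_minus minus_add a_ac)
  define u where "u = b \<otimes> r"
  have u: "u \<in> carrier A" using c by (simp add: u_def)
  have star_r: "star A r \<in> carrier A" "star A r \<otimes> b = \<one>"
    using c star_mult[of a r] by (simp_all add: star_closed ar star_one star_a)
  have "star A u \<otimes> u = star A r \<otimes> (a \<otimes> b) \<otimes> r"
    using c star_r by (simp add: u_def star_mult star_b m_assoc)
  also have "\<dots> = (star A r \<otimes> b) \<otimes> (a \<otimes> r)"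
    using c star_r(1) by (simp add: ab m_assoc)
  finally have "star A u \<otimes> u = \<one>"
    using star_r ar by simp
  with u have nu: "nrm A u \<le> 1"
    by (rule nrm_le_one_of_isometry)
  have hr: "a \<otimes> r = h \<otimes> r \<oplus> e \<otimes> r" "u = h \<otimes> r \<ominus> e \<otimes> r"
    using h e c by (simp_all add: u_def a_def b_def minus_eq l_distr l_minus)
  have two: "x \<oplus> x = 2 \<odot> x" if "x \<in> carrier A" for x
    using scale_add_left[OF that, of 1 1] scale_one[OF that] by simp
  have "\<one> \<ominus> u = (2 * \<i> * s) \<odot> r"
  proof -
    have "\<one> \<ominus> u = e \<otimes> r \<oplus> e \<otimes> r"
      unfolding ar[symmetric] hr using h e c by algebra
    then show ?thesis
      using c by (simp add: two e_def scale_one_mult scale_closed scale_scale[symmetric] mult.assoc)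
  qed
  then have "2 * s * nrm A r = nrm A (\<one> \<ominus> u)"
    using c s by (simp add: nrm_scale norm_mult)
  also have "\<dots> \<le> 2"
    using nrm_diff_triangle[of \<one> u] u nrm_one_le nu by simp
  finally show "nrm A r \<le> 1 / s"
    using s by (simp add: field_simps)
  have "\<one> \<oplus> u = h \<otimes> r \<oplus> h \<otimes> r"
    unfolding ar[symmetric] hr using h e c by algebra
  then have "2 * nrm A (h \<otimes> r) = nrm A (\<one> \<oplus> u)"
    using h c by (simp add: two nrm_scale)
  also have "\<dots> \<le> 2"
    using nrm_triangle[of \<one> u] u nrm_one_le nu by simp
  finally show "nrm A (h \<otimes> r) \<le> 1" by simp
qed

text \<open>This is the statement that self-adjoint elements have real spectrum.  For \<open>s > \<parallel>h\<parallel>\<close> the element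
  \<open>h + is\<close> is a small perturbation of \<open>is\<close>.  If \<open>h + it\<close> is invertible, its inverse has norm at most
  \<open>1/t\<close>, so \<open>h + i(t/2)\<close>, which is at distance at most \<open>t/2\<close>, is invertible too.  Halving repeatedly
  from a large value of the form \<open>2\<^sup>n s\<close> leads down to \<open>s\<close>.\<close>

lemma self_adjoint_plus_imaginary_Units:
  fixes s :: real
  assumes h: "h \<in> carrier A" "star A h = h" and s: "0 < s"
  shows "h \<oplus> (\<i> * s) \<odot> \<one> \<in> Units A"
proof -
  have large: "h \<oplus> (\<i> * t) \<odot> \<one> \<in> Units A" if t: "nrm A h < t" for t :: real
  proof (rule Units_perturb)
    have t0: "0 < t" using t nrm_nonneg[OF h(1)] by simp
    define c where "c = (\<i> * t) \<odot> \<one>"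
    define d where "d = (1 / (\<i> * t)) \<odot> \<one>"
    have cd: "c \<in> carrier A" "d \<in> carrier A" "c \<otimes> d = \<one>" "d \<otimes> c = \<one>"
      using t0 unfolding c_def d_def
      by (simp_all add: scale_closed scale_one_mult scale_scale[symmetric] scale_one)
    then have unit: "c \<in> Units A" and inv: "inv c = d"
      by (auto simp: Units_def intro: inv_unique'[symmetric])
    show "(\<i> * t) \<odot> \<one> \<in> Units A" "h \<oplus> (\<i> * t) \<odot> \<one> \<in> carrier A"
      using unit h by (simp_all add: c_def scale_closed)
    have "c \<ominus> (h \<oplus> c) = \<ominus> h"
      using cd h by algebra
    then have "nrm A (inv c) * nrm A (c \<ominus> (h \<oplus> c)) \<le> 1 / t * nrm A h"
      using mult_right_mono[OF nrm_scale_one_le[of "1 / (\<i> * t)"] nrm_nonneg[OF h(1)]] t0 h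
      by (simp add: inv nrm_minus d_def norm_divide norm_mult)
    also have "\<dots> < 1" using t t0 by simp
    finally show "nrm A (inv ((\<i> * t) \<odot> \<one>)) * nrm A ((\<i> * t) \<odot> \<one> \<ominus> (h \<oplus> (\<i> * t) \<odot> \<one>)) < 1"
      by (simp add: c_def)
  qed
  have halve: "h \<oplus> (\<i> * (t / 2)) \<odot> \<one> \<in> Units A"
    if t: "0 < t" and unit: "h \<oplus> (\<i> * t) \<odot> \<one> \<in> Units A" for t :: real
  proof (rule Units_perturb[OF unit])
    have split: "(\<i> * complex_of_real t) \<odot> \<one> = (\<i> * (t / 2)) \<odot> \<one> \<oplus> (\<i> * (t / 2)) \<odot> \<one>"
      by (simp add: scale_add_left[symmetric])
    have "(h \<oplus> (\<i> * t) \<odot> \<one>) \<ominus> (h \<oplus> (\<i> * (t / 2)) \<odot> \<one>) = (\<i> * (t / 2)) \<odot> \<one>"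
      unfolding split using h scale_closed[OF one_closed, of "\<i> * (t / 2)"] by algebra
    moreover have "nrm A ((\<i> * (t / 2)) \<odot> \<one>) \<le> t / 2"
      using nrm_scale_one_le[of "\<i> * (t / 2)"] t by (simp add: norm_mult)
    ultimately have "nrm A (inv (h \<oplus> (\<i> * t) \<odot> \<one>)) *
        nrm A ((h \<oplus> (\<i> * t) \<odot> \<one>) \<ominus> (h \<oplus> (\<i> * (t / 2)) \<odot> \<one>)) \<le> 1 / t * (t / 2)"
      using self_adjoint_resolvent_bounds(1)[OF h t unit] t
      by (intro mult_mono) (auto simp: nrm_nonneg scale_closed)
    then show "nrm A (inv (h \<oplus> (\<i> * t) \<odot> \<one>)) *
        nrm A ((h \<oplus> (\<i> * t) \<odot> \<one>) \<ominus> (h \<oplus> (\<i> * (t / 2)) \<odot> \<one>)) < 1"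
      using t by simp
  qed (use h in \<open>simp add: scale_closed\<close>)
  have "h \<oplus> (\<i> * (2 ^ n * s / 2 ^ k)) \<odot> \<one> \<in> Units A" if n: "nrm A h < 2 ^ n * s" for n k :: nat
  proof (induction k)
    case 0
    then show ?case using large[OF n] by simp
  next
    case (Suc k)
    then show ?case using halve[of "2 ^ n * s / 2 ^ k"] s by (simp add: field_simps)
  qed
  moreover obtain n :: nat where "nrm A h / s < 2 ^ n"
    using real_arch_pow[of 2 "nrm A h / s"] by auto
  then have "nrm A h < 2 ^ n * s" using s by (simp add: field_simps)
  ultimately show ?thesis by (metis nonzero_mult_div_cancel_left power_not_zero zero_neq_numeral)
qed

text \<open>Take \<open>u = h\<^sup>2 (h\<^sup>2 + s\<^sup>2)\<^sup>-\<^sup>1\<close> with \<open>h = x\<^sup>* x\<close>; it lies in \<open>I\<close> since \<open>h\<close> does.  Then \<open>1 - u = s\<^sup>2 r r\<^sup>*\<close> has norm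
  at most \<open>1\<close>, where \<open>r = (h + is)\<^sup>-\<^sup>1\<close>, and the C*-identity gives
  \<open>\<parallel>x (1 - u)\<parallel>\<^sup>2 = \<parallel>(1 - u)\<^sup>* h (1 - u)\<parallel> \<le> \<parallel>h (1 - u)\<parallel> \<le> s\<close>.\<close>

lemma approximate_right_unit:
  assumes I: "ideal I A" and x: "x \<in> I" and "0 < \<epsilon>"
  shows "\<exists>u\<in>I. nrm A u \<le> 2 \<and> nrm A (x \<ominus> x \<otimes> u) < \<epsilon>"
proof -
  interpret I: ideal I A by fact
  have xc: "x \<in> carrier A" using x by simp
  define h where "h = star A x \<otimes> x"
  have h: "h \<in> carrier A" "star A h = h"
    using xc by (simp_all add: h_def star_closed star_mult star_star)
  \<comment> \<open>the square of the norm in question is going to be at most \<open>s\<close>\<close>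
  define s where "s = \<epsilon>\<^sup>2 / 2"
  have s: "0 < s" using \<open>0 < \<epsilon>\<close> by (simp add: s_def)
  define e where "e = (\<i> * s) \<odot> \<one>"
  define a where "a = h \<oplus> e"
  define r where "r = inv a"
  define q where "q = star A r"
  have e: "e \<in> carrier A" "star A e = \<ominus> e"
    by (simp_all add: e_def scale_closed star_scale star_one
        scale_minus_one[symmetric] scale_scale[symmetric])
  have ee: "e \<otimes> e = \<ominus> (s\<^sup>2 \<odot> \<one>)"
  proof -
    have "(\<i> * complex_of_real s) * (\<i> * s) = (-1) * complex_of_real (s\<^sup>2)"
      by (simp add: complex_eq_iff power2_eq_square)
    moreover have "e \<otimes> e = ((\<i> * complex_of_real s) * (\<i> * s)) \<odot> \<one>"
      by (simp only: e_def scale_one_mult scale_closed scale_scale[symmetric] one_closed)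
    ultimately show ?thesis
      by (simp only: scale_scale scale_minus_one scale_closed one_closed)
  qed
  have eh: "h \<otimes> e = e \<otimes> h"
    using h by (simp add: e_def scale_one_mult)
  have unit: "a \<in> Units A"
    using self_adjoint_plus_imaginary_Units[OF h s] by (simp add: a_def e_def)
  then have c: "a \<in> carrier A" "r \<in> carrier A" "q \<in> carrier A" and ar: "a \<otimes> r = \<one>" "r \<otimes> a = \<one>"
    by (auto simp: r_def q_def star_closed)
  have nr: "nrm A r \<le> 1 / s" "nrm A (h \<otimes> r) \<le> 1"
    using self_adjoint_resolvent_bounds[OF h s] unit by (simp_all add: a_def e_def r_def)
  define b where "b = h \<ominus> e"
  have bc: "b \<in> carrier A" using h e by (simp add: b_def)
  have star_a: "star A a = b"
    using h e by (simp add: a_def b_def star_add minus_eq)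
  have bq: "b \<otimes> q = \<one>"
    using c star_mult[of r a] by (simp add: ar star_one star_a q_def)
  have ba: "b \<otimes> a = h \<otimes> h \<oplus> s\<^sup>2 \<odot> \<one>"
  proof -
    have "b \<otimes> a = h \<otimes> h \<ominus> e \<otimes> e \<oplus> (h \<otimes> e \<ominus> e \<otimes> h)"
      unfolding a_def b_def using h(1) e(1) by algebra
    then show ?thesis
      using h(1) e(1) by (simp add: ee eh minus_eq scale_closed r_neg)
  qed
  define w where "w = r \<otimes> q"
  define u where "u = h \<otimes> h \<otimes> w"
  have wc: "w \<in> carrier A" using c by (simp add: w_def)
  have nw: "nrm A w \<le> 1 / s\<^sup>2"
  proof -
    have "nrm A w \<le> nrm A r * nrm A q" unfolding w_def using nrm_mult c by simp
    also have "\<dots> = nrm A r * nrm A r" using c by (simp add: q_def nrm_star)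
    also have "\<dots> \<le> 1 / s * (1 / s)"
      using nr s c by (intro mult_mono) (auto simp: nrm_nonneg)
    finally show ?thesis by (simp add: power2_eq_square)
  qed
  have v: "\<one> \<ominus> u = s\<^sup>2 \<odot> w"
  proof -
    have "(h \<otimes> h \<oplus> s\<^sup>2 \<odot> \<one>) \<otimes> w = b \<otimes> (a \<otimes> r) \<otimes> q"
      unfolding ba[symmetric] w_def using c bc by (simp add: m_assoc)
    then have "u \<oplus> s\<^sup>2 \<odot> w = \<one>"
      using h wc c bc by (simp add: u_def ar bq l_distr scale_closed scale_one_mult)
    then show ?thesis
      using h wc scale_closed[OF wc, of "s\<^sup>2"] by (metis u_def minus_eq a_comm add.inv_solve_right m_closed one_closed)
  qed
  have "u \<in> I"
    using x xc h wc by (simp add: u_def h_def star_closed I.I_l_closed I.I_r_closed)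
  moreover have uc: "u \<in> carrier A" using h wc by (simp add: u_def)
  have nv: "nrm A (\<one> \<ominus> u) \<le> 1"
    unfolding v using nw s wc by (simp add: nrm_scale field_simps norm_power)
  have "nrm A u \<le> 2"
  proof -
    have "u = \<one> \<ominus> (\<one> \<ominus> u)" using uc one_closed by algebra
    then show ?thesis
      using nrm_diff_triangle[of \<one> "\<one> \<ominus> u"] nrm_one_le nv uc by simp
  qed
  moreover have "nrm A (x \<ominus> x \<otimes> u) < \<epsilon>"
  proof -
    define y where "y = \<one> \<ominus> u"
    have y: "y \<in> carrier A" using uc by (simp add: y_def)
    have xy: "x \<ominus> x \<otimes> u = x \<otimes> y"
      using xc uc by (simp add: y_def minus_eq r_distr r_minus)
    have "(nrm A (x \<otimes> y))\<^sup>2 = nrm A (star A y \<otimes> (h \<otimes> y))"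
      using cstar_identity[of "x \<otimes> y"] xc y by (simp add: star_mult h_def m_assoc star_closed)
    also have "\<dots> \<le> nrm A (star A y) * nrm A (h \<otimes> y)"
      using nrm_mult y h by (simp add: star_closed)
    also have "\<dots> \<le> 1 * nrm A (h \<otimes> y)"
      using nv y h by (intro mult_right_mono) (auto simp: nrm_star y_def nrm_nonneg)
    also have "h \<otimes> y = s\<^sup>2 \<odot> ((h \<otimes> r) \<otimes> q)"
      unfolding y_def v using h c wc by (simp add: scale_mult_right w_def m_assoc)
    also have "1 * nrm A (s\<^sup>2 \<odot> ((h \<otimes> r) \<otimes> q)) = s\<^sup>2 * nrm A ((h \<otimes> r) \<otimes> q)"
      using h c by (simp add: nrm_scale norm_power)
    also have "\<dots> \<le> s\<^sup>2 * (nrm A (h \<otimes> r) * nrm A q)"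
      using nrm_mult h c by (intro mult_left_mono) auto
    also have "\<dots> \<le> s\<^sup>2 * (1 * (1 / s))"
      using nr h c s by (intro mult_left_mono mult_mono) (auto simp: nrm_nonneg q_def nrm_star)
    also have "\<dots> = s" using s by (simp add: power2_eq_square)
    also have "\<dots> < \<epsilon>\<^sup>2" using \<open>0 < \<epsilon>\<close> by (simp add: s_def)
    finally show ?thesis
      unfolding xy using \<open>0 < \<epsilon>\<close> by (intro power2_less_imp_less[of _ \<epsilon>]) auto
  qed
  ultimately show ?thesis by blast
qed

section \<open>Sums and closures of ideals\<close>

lemma closure_of_norm_topology:
  assumes "S \<subseteq> carrier A"
  shows "norm_topology A closure_of S =
    {x \<in> carrier A. \<forall>\<epsilon>>0. \<exists>y\<in>S. nrm A (x \<ominus> y) < \<epsilon>}"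
proof -
  have "x \<in> carrier A \<Longrightarrow> y \<in> S \<Longrightarrow> y \<in> mball x \<epsilon> \<longleftrightarrow> nrm A (x \<ominus> y) < \<epsilon>" for x y \<epsilon>
    using assms by (auto simp: alg_dist_def)
  then show ?thesis
    unfolding norm_topology_def metric_closure_of by blast
qed

lemma closedin_norm_topology:
  "closedin (norm_topology A) S \<longleftrightarrow>
    S \<subseteq> carrier A \<and> (\<forall>x\<in>carrier A. (\<forall>\<epsilon>>0. \<exists>y\<in>S. nrm A (x \<ominus> y) < \<epsilon>) \<longrightarrow> x \<in> S)"
proof (cases "S \<subseteq> carrier A")
  case True
  then have "S \<subseteq> norm_topology A closure_of S"
    by (intro closure_of_subset) (simp add: norm_topology_def)
  then have "closedin (norm_topology A) S \<longleftrightarrow> norm_topology A closure_of S \<subseteq> S"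
    by (metis closedin_closure_of closure_of_closedin order_refl subset_antisym)
  then show ?thesis
    using True by (auto simp: closure_of_norm_topology)
next
  case False
  then show ?thesis
    using closedin_subset[of "norm_topology A" S] by (auto simp: norm_topology_def)
qed

text \<open>In a unital algebra scalar multiplication is multiplication by \<open>c \<odot> \<one>\<close>, so ring ideals are already
  subspaces.\<close>

lemma closed_ideal_iff: "I \<in> closed_ideals A \<longleftrightarrow> ideal I A \<and> closedin (norm_topology A) I"
proof
  assume "I \<in> closed_ideals A"
  then show "ideal I A \<and> closedin (norm_topology A) I"
    unfolding closed_ideals_def closed_ideal_def
    by (auto simp: ring_axioms intro!: idealI additive_subgroup.a_subgroup)
next
  assume I: "ideal I A \<and> closedin (norm_topology A) I"
  then interpret I: ideal I A by simp
  have "c \<odot> x \<in> I" if "x \<in> I" for c x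
    using I.I_l_closed[OF that scale_closed[OF one_closed, of c]] that
    by (simp add: scale_one_mult)
  then show "I \<in> closed_ideals A"
    using I unfolding closed_ideals_def closed_ideal_def
    by (auto simp: I.I_l_closed I.I_r_closed I.is_additive_subgroup)
qed

lemma closed_idealD:
  assumes "I \<in> closed_ideals A"
  shows "ideal I A"
    and "I \<subseteq> carrier A"
    and "\<lbrakk>x \<in> carrier A; \<And>\<epsilon>. 0 < \<epsilon> \<Longrightarrow> \<exists>y\<in>I. nrm A (x \<ominus> y) < \<epsilon>\<rbrakk> \<Longrightarrow> x \<in> I"
  using assms unfolding closed_ideal_iff closedin_norm_topology by blast+

text \<open>The summands of an element of \<open>I + K\<close> can be chosen with norms controlled by the sum.  For \<open>u \<in> I\<close>
  with \<open>\<parallel>u\<parallel> \<le> 2\<close> and \<open>x u\<close> close to \<open>x\<close>, the element \<open>x + k u\<close> of \<open>I\<close> equals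
  \<open>(x - x u) + (x + k) u\<close>, whose norm is at most \<open>3 \<parallel>x + k\<parallel>\<close>.\<close>

lemma sum_representative_bound:
  assumes I: "ideal I A" and K: "ideal K A" and x: "x \<in> I" and k: "k \<in> K"
  shows "\<exists>x'\<in>I. \<exists>k'\<in>K. x' \<oplus> k' = x \<oplus> k \<and> nrm A x' \<le> 3 * nrm A (x \<oplus> k)"
proof -
  interpret I: ideal I A by fact
  interpret K: ideal K A by fact
  have c: "x \<in> carrier A" "k \<in> carrier A" using x k by auto
  show ?thesis
  proof (cases "nrm A (x \<oplus> k) = 0")
    case True
    then have "x \<oplus> k = \<zero>" using c nrm_eq_zero by simp
    then show ?thesis
      using I.zero_closed K.zero_closed nrm_eq_zero[of \<zero>] by (intro bexI[of _ \<zero>]) auto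
  next
    case False
    then have pos: "0 < nrm A (x \<oplus> k)" using nrm_nonneg[of "x \<oplus> k"] c by simp
    from approximate_right_unit[OF I x pos]
    obtain u where u: "u \<in> I" "nrm A u \<le> 2" "nrm A (x \<ominus> x \<otimes> u) < nrm A (x \<oplus> k)" by blast
    have uc: "u \<in> carrier A" using u by simp
    \<comment> \<open>\<open>k \<otimes> u\<close> lies in both ideals, so it can be moved from one summand to the other\<close>
    have kuI: "k \<otimes> u \<in> I" using I.I_l_closed u(1) c(2) by simp
    have kuK: "k \<otimes> u \<in> K" using K.I_r_closed uc k by simp
    have "(x \<oplus> k \<otimes> u) \<oplus> (k \<ominus> k \<otimes> u) = x \<oplus> k"
      using c uc by algebra
    moreover have "nrm A (x \<oplus> k \<otimes> u) \<le> 3 * nrm A (x \<oplus> k)"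
    proof -
      have "x \<oplus> k \<otimes> u = (x \<ominus> x \<otimes> u) \<oplus> (x \<oplus> k) \<otimes> u"
        using c uc by algebra
      then have "nrm A (x \<oplus> k \<otimes> u) \<le> nrm A (x \<ominus> x \<otimes> u) + nrm A ((x \<oplus> k) \<otimes> u)"
        using nrm_triangle c uc by simp
      also have "nrm A ((x \<oplus> k) \<otimes> u) \<le> nrm A (x \<oplus> k) * nrm A u"
        using nrm_mult c uc by simp
      also have "\<dots> \<le> nrm A (x \<oplus> k) * 2"
        using u pos by simp
      finally show ?thesis using u(3) by simp
    qed
    ultimately show ?thesis
      using x kuI k kuK by (metis I.a_closed K.a_closed K.a_inv_closed minus_eq)
  qed
qed

lemma set_add_iff: "z \<in> I <+> K \<longleftrightarrow> (\<exists>x\<in>I. \<exists>k\<in>K. z = x \<oplus> k)"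
  by (auto simp: set_add_def')

text \<open>Approximate a limit \<open>z\<close> of \<open>I + K\<close> by \<open>X\<^sub>n + k\<^sub>n\<close> up to \<open>2\<^sup>-\<^sup>n\<close>.  By the norm bound above, the
  \<open>I\<close>-parts can be chosen with \<open>\<parallel>X\<^sub>n - X\<^sub>n\<^sub>+\<^sub>1\<parallel> \<le> 6 * 2\<^sup>-\<^sup>n\<close>, so they converge to some \<open>x \<in> I\<close>, and
  \<open>z - x\<close> is then a limit of the \<open>k\<^sub>n\<close>.\<close>

lemma add_closed_ideals:
  assumes I: "I \<in> closed_ideals A" and K: "K \<in> closed_ideals A"
  shows "I <+> K \<in> closed_ideals A"
  unfolding closed_ideal_iff closedin_norm_topology
proof (intro conjI ballI impI)
  interpret I: ideal I A by (rule closed_idealD[OF I])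
  interpret K: ideal K A by (rule closed_idealD[OF K])
  show "ideal (I <+> K) A"
    using add_ideals I.ideal_axioms K.ideal_axioms by blast
  show "I <+> K \<subseteq> carrier A"
    using setadd_subset_G I.a_subset K.a_subset by blast
  fix z assume zc: "z \<in> carrier A" and z: "\<forall>\<epsilon>>0. \<exists>y\<in>I <+> K. nrm A (z \<ominus> y) < \<epsilon>"
  define near where "near n x \<longleftrightarrow> x \<in> I \<and> (\<exists>k\<in>K. nrm A (z \<ominus> (x \<oplus> k)) < (1/2) ^ n)" for n :: nat and x
  have "\<exists>X. \<forall>n. near n (X n) \<and> nrm A (X n \<ominus> X (Suc n)) \<le> 6 * (1/2) ^ n"
  proof (rule dependent_nat_choice)
    obtain y where "y \<in> I <+> K" "nrm A (z \<ominus> y) < 1"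
      using z by (meson zero_less_one)
    then show "\<exists>x. near 0 x"
      by (auto simp: near_def set_add_iff)
    fix x n assume "near n x"
    then obtain k where xk: "x \<in> I" "k \<in> K" "nrm A (z \<ominus> (x \<oplus> k)) < (1/2) ^ n"
      by (auto simp: near_def)
    have "0 < (1/2 :: real) ^ Suc n" by simp
    with z obtain y where "y \<in> I <+> K" "nrm A (z \<ominus> y) < (1/2) ^ Suc n" by blast
    then obtain x1 k1 where x1: "x1 \<in> I" "k1 \<in> K" "nrm A (z \<ominus> (x1 \<oplus> k1)) < (1/2) ^ Suc n"
      by (auto simp: set_add_iff)
    have c: "x \<in> carrier A" "k \<in> carrier A" "x1 \<in> carrier A" "k1 \<in> carrier A"
      using xk x1 by auto
    have "(x1 \<ominus> x) \<in> I" "(k1 \<ominus> k) \<in> K"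
      using xk x1 by (auto simp: minus_eq)
    from sum_representative_bound[OF I.ideal_axioms K.ideal_axioms this]
    obtain x2 k2 where x2: "x2 \<in> I" "k2 \<in> K" "x2 \<oplus> k2 = (x1 \<ominus> x) \<oplus> (k1 \<ominus> k)"
      "nrm A x2 \<le> 3 * nrm A ((x1 \<ominus> x) \<oplus> (k1 \<ominus> k))" by blast
    have c2: "x2 \<in> carrier A" "k2 \<in> carrier A" using x2 by auto
    have "(x1 \<ominus> x) \<oplus> (k1 \<ominus> k) = (x1 \<oplus> k1) \<ominus> (x \<oplus> k)"
      using c by algebra
    then have "nrm A ((x1 \<ominus> x) \<oplus> (k1 \<ominus> k)) \<le> nrm A ((x1 \<oplus> k1) \<ominus> z) + nrm A (z \<ominus> (x \<oplus> k))"
      using nrm_diff_trans c zc by simp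
    also have "\<dots> \<le> 2 * (1/2) ^ n"
    proof -
      have "(1/2 :: real) ^ Suc n \<le> (1/2) ^ n" by simp
      moreover have "nrm A (z \<ominus> (x1 \<oplus> k1)) = nrm A ((x1 \<oplus> k1) \<ominus> z)"
        using nrm_diff_commute c zc by simp
      ultimately show ?thesis
        using x1(3) xk(3) by linarith
    qed
    finally have small: "nrm A x2 \<le> 6 * (1/2) ^ n" using x2(4) by simp
    have "(x \<oplus> x2) \<oplus> (k \<oplus> k2) = (x \<oplus> k) \<oplus> (x2 \<oplus> k2)"
      using c c2 by algebra
    also have "\<dots> = x1 \<oplus> k1"
      unfolding x2(3) using c by algebra
    finally have "near (Suc n) (x \<oplus> x2)"
      unfolding near_def using x1(3) xk x2 by (auto intro!: bexI[of _ "k \<oplus> k2"])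
    moreover have "x \<ominus> (x \<oplus> x2) = \<ominus> x2"
      using c c2 by algebra
    ultimately show "\<exists>y. near (Suc n) y \<and> nrm A (x \<ominus> y) \<le> 6 * (1/2) ^ n"
      using small c2 nrm_minus by auto
  qed
  then obtain X where X: "\<And>n. near n (X n)"
    and step: "\<And>n. nrm A (X n \<ominus> X (Suc n)) \<le> 6 * (1/2) ^ n" by blast
  have XI: "X n \<in> I" and Xc: "X n \<in> carrier A" for n
    using X[of n] by (auto simp: near_def)
  \<comment> \<open>partial sums of the geometric series with first term \<open>6 * (1/2) ^ n\<close>\<close>
  have tail: "nrm A (X n \<ominus> X (n + m)) \<le> 12 * ((1/2) ^ n - (1/2) ^ (n + m))" for n m
  proof (induction m)
    case 0
    then show ?case using Xc nrm_eq_zero[of \<zero>] by (simp add: minus_eq r_neg)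
  next
    case (Suc m)
    then show ?case
      using nrm_diff_trans[OF Xc[of n] Xc[of "n + m"] Xc[of "Suc (n + m)"]] step[of "n + m"] by simp
  qed
  have pow_small: "\<exists>N. \<forall>n\<ge>N. c * (1/2) ^ n < \<epsilon>" if "0 < \<epsilon>" for c \<epsilon> :: real
  proof -
    have "(\<lambda>n. c * (1/2) ^ n) \<longlonglongrightarrow> 0"
      by (intro tendsto_mult_right_zero LIMSEQ_realpow_zero) auto
    then show ?thesis
      using order_tendstoD(2)[OF _ that] eventually_sequentially by force
  qed
  have "MCauchy X"
    unfolding MCauchy_def
  proof (intro conjI allI impI)
    fix \<epsilon> :: real assume "0 < \<epsilon>"
    then obtain N where N: "\<And>n. N \<le> n \<Longrightarrow> 12 * (1/2) ^ n < \<epsilon>" using pow_small by blast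
    have le: "alg_dist A (X n) (X n') < \<epsilon>" if "N \<le> n" "n \<le> n'" for n n'
    proof -
      have "nrm A (X n \<ominus> X n') \<le> 12 * ((1/2) ^ n - (1/2) ^ n')"
        using tail[of n "n' - n"] that by simp
      also have "\<dots> \<le> 12 * (1/2) ^ n" by simp
      also have "\<dots> < \<epsilon>" using N that by simp
      finally show ?thesis using Xc by (simp add: alg_dist_def)
    qed
    show "\<exists>N. \<forall>n n'. N \<le> n \<longrightarrow> N \<le> n' \<longrightarrow> alg_dist A (X n) (X n') < \<epsilon>"
    proof (intro exI[of _ N] allI impI)
      fix n n' assume "N \<le> n" "N \<le> n'"
      then show "alg_dist A (X n) (X n') < \<epsilon>"
        using le[of n n'] le[of n' n] commute[of "X n" "X n'"] by linarith
    qed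
  qed (use Xc in auto)
  then obtain x where "limitin mtopology X x sequentially"
    using complete unfolding mcomplete_def by blast
  then have xc: "x \<in> carrier A" and lim: "\<And>\<epsilon>. 0 < \<epsilon> \<Longrightarrow> \<exists>N. \<forall>n\<ge>N. nrm A (X n \<ominus> x) < \<epsilon>"
    unfolding limit_metric_sequentially using Xc by (auto simp: alg_dist_def)
  have "x \<in> I"
  proof (rule closed_idealD(3)[OF I xc])
    fix \<epsilon> :: real assume "0 < \<epsilon>"
    from lim[OF this] obtain N where "nrm A (X N \<ominus> x) < \<epsilon>" by blast
    then show "\<exists>y\<in>I. nrm A (x \<ominus> y) < \<epsilon>"
      using XI[of N] nrm_diff_commute[OF xc Xc[of N]] by (intro bexI[of _ "X N"]) simp_all
  qed
  moreover have "z \<ominus> x \<in> K"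
  proof (rule closed_idealD(3)[OF K])
    fix \<epsilon> :: real assume "0 < \<epsilon>"
    then have "0 < \<epsilon> / 2" by simp
    from lim[OF this] pow_small[OF this, of 1] obtain N1 N2
      where N1: "\<And>n. N1 \<le> n \<Longrightarrow> nrm A (X n \<ominus> x) < \<epsilon> / 2"
        and N2: "\<And>n. N2 \<le> n \<Longrightarrow> 1 * (1/2) ^ n < \<epsilon> / 2" by blast
    define n where "n = max N1 N2"
    obtain k where k: "k \<in> K" "nrm A (z \<ominus> (X n \<oplus> k)) < (1/2) ^ n"
      using X[of n] by (auto simp: near_def)
    have kc: "k \<in> carrier A" using k by simp
    have "(z \<ominus> x) \<ominus> k = (z \<ominus> (X n \<oplus> k)) \<oplus> (X n \<ominus> x)"
      using zc xc kc Xc[of n] by algebra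
    then have "nrm A ((z \<ominus> x) \<ominus> k) \<le> nrm A (z \<ominus> (X n \<oplus> k)) + nrm A (X n \<ominus> x)"
      using nrm_triangle zc xc kc Xc by simp
    also have "\<dots> < \<epsilon>"
      using N1[of n] N2[of n] k(2) by (simp add: n_def)
    finally show "\<exists>y\<in>K. nrm A ((z \<ominus> x) \<ominus> y) < \<epsilon>" using k(1) by blast
  qed (use zc xc in simp)
  moreover have "z = x \<oplus> (z \<ominus> x)"
    using zc xc by algebra
  ultimately show "z \<in> I <+> K"
    unfolding set_add_iff by blast
qed

lemma closure_of_ideal:
  assumes I: "ideal I A"
  shows "norm_topology A closure_of I \<in> closed_ideals A"
proof -
  interpret I: ideal I A by fact
  let ?C = "{x \<in> carrier A. \<forall>\<epsilon>>0. \<exists>y\<in>I. nrm A (x \<ominus> y) < \<epsilon>}"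
  have C: "norm_topology A closure_of I = ?C"
    using I.a_subset by (rule closure_of_norm_topology)
  have lipschitz: "f x \<in> ?C"
    if x: "x \<in> ?C" and c: "0 < c" and f: "\<And>y. y \<in> I \<Longrightarrow> f y \<in> I" "f x \<in> carrier A"
      and lip: "\<And>y. y \<in> I \<Longrightarrow> nrm A (f x \<ominus> f y) \<le> c * nrm A (x \<ominus> y)" for f x c
  proof -
    have "\<exists>y\<in>I. nrm A (f x \<ominus> y) < \<epsilon>" if "0 < \<epsilon>" for \<epsilon>
    proof -
      have "0 < \<epsilon> / c" using that c by simp
      with x obtain y where "y \<in> I" "nrm A (x \<ominus> y) < \<epsilon> / c" by blast
      then show ?thesis
        using lip[of y] f(1)[of y] c by (intro bexI[of _ "f y"]) (auto simp: field_simps)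
    qed
    then show ?thesis using f(2) by simp
  qed
  have mult_bound: "b * t \<le> (b + 1) * t" if "0 \<le> t" for b t :: real
    using that by (simp add: algebra_simps)
  have "ideal ?C A"
  proof (rule idealI[OF ring_axioms])
    show "subgroup ?C (add_monoid A)"
    proof (rule add.subgroupI)
      have "nrm A (\<zero> \<ominus> \<zero>) = 0" using nrm_eq_zero[of \<zero>] by (simp add: minus_eq)
      then have "\<zero> \<in> ?C" using I.zero_closed by (auto intro!: bexI[of _ \<zero>])
      then show "?C \<noteq> {}" by blast
      show "\<ominus> x \<in> ?C" if "x \<in> ?C" for x
      proof (rule lipschitz[OF that, of 1])
        fix y assume "y \<in> I"
        then have "x \<in> carrier A" "y \<in> carrier A" using that by auto
        moreover from this have "\<ominus> x \<ominus> \<ominus> y = y \<ominus> x" by algebra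
        ultimately show "nrm A (\<ominus> x \<ominus> \<ominus> y) \<le> 1 * nrm A (x \<ominus> y)"
          using nrm_diff_commute by simp
      qed (use that in auto)
      show "x \<oplus> y \<in> ?C" if "x \<in> ?C" "y \<in> ?C" for x y
      proof -
        have "\<exists>w\<in>I. nrm A ((x \<oplus> y) \<ominus> w) < \<epsilon>" if "0 < \<epsilon>" for \<epsilon>
        proof -
          have "0 < \<epsilon> / 2" using that by simp
          then obtain v w where vw: "v \<in> I" "nrm A (x \<ominus> v) < \<epsilon> / 2" "w \<in> I" "nrm A (y \<ominus> w) < \<epsilon> / 2"
            using \<open>x \<in> ?C\<close> \<open>y \<in> ?C\<close> by blast
          have c: "x \<in> carrier A" "y \<in> carrier A" "v \<in> carrier A" "w \<in> carrier A"
            using \<open>x \<in> ?C\<close> \<open>y \<in> ?C\<close> vw by auto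
          then have "(x \<oplus> y) \<ominus> (v \<oplus> w) = (x \<ominus> v) \<oplus> (y \<ominus> w)" by algebra
          then have "nrm A ((x \<oplus> y) \<ominus> (v \<oplus> w)) < \<epsilon>"
            using nrm_triangle[of "x \<ominus> v" "y \<ominus> w"] vw c by simp
          then show ?thesis using vw by blast
        qed
        then show ?thesis using that by simp
      qed
    qed auto
    fix a x assume a: "a \<in> ?C" and x: "x \<in> carrier A"
    have pos: "0 < nrm A x + 1" using nrm_nonneg[OF x] by simp
    show "x \<otimes> a \<in> ?C"
    proof (rule lipschitz[OF a pos])
      fix y assume "y \<in> I"
      then have c: "a \<in> carrier A" "y \<in> carrier A" using a by auto
      then have "nrm A (x \<otimes> a \<ominus> x \<otimes> y) \<le> nrm A x * nrm A (a \<ominus> y)"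
        using nrm_mult[of x "a \<ominus> y"] x by (simp add: minus_eq r_distr r_minus)
      also have "\<dots> \<le> (nrm A x + 1) * nrm A (a \<ominus> y)"
        using mult_bound nrm_nonneg c by simp
      finally show "nrm A (x \<otimes> a \<ominus> x \<otimes> y) \<le> (nrm A x + 1) * nrm A (a \<ominus> y)" .
    qed (use a x in \<open>auto simp: I.I_l_closed\<close>)
    show "a \<otimes> x \<in> ?C"
    proof (rule lipschitz[OF a pos, of "\<lambda>y. y \<otimes> x"])
      fix y assume "y \<in> I"
      then have c: "a \<in> carrier A" "y \<in> carrier A" using a by auto
      then have "nrm A (a \<otimes> x \<ominus> y \<otimes> x) \<le> nrm A x * nrm A (a \<ominus> y)"
        using nrm_mult[of "a \<ominus> y" x] x by (simp add: minus_eq l_distr l_minus mult.commute)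
      also have "\<dots> \<le> (nrm A x + 1) * nrm A (a \<ominus> y)"
        using mult_bound nrm_nonneg c by simp
      finally show "nrm A (a \<otimes> x \<ominus> y \<otimes> x) \<le> (nrm A x + 1) * nrm A (a \<ominus> y)" .
    qed (use a x in \<open>auto simp: I.I_r_closed\<close>)
  qed
  then show ?thesis
    unfolding closed_ideal_iff C[symmetric] by simp
qed

end

section \<open>Closed ideals of a quotient\<close>

locale closed_ideal_quotient = unital_cstar_algebra + I: ideal I A for I +
  assumes I_closed: "I \<in> closed_ideals A"
begin

abbreviation Q where "Q \<equiv> quotient_algebra A I"
abbreviation proj where "proj x \<equiv> I +> x"

lemma carrier_Q: "carrier Q = proj ` carrier A"
  by (auto simp: quotient_algebra_def A_RCOSETS_def')

lemma Q_simps: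
  "zero Q = I" "add Q = set_add A" "monoid.mult Q = rcoset_mult A I"
  "nrm Q = (\<lambda>X. Inf (nrm A ` X))"
  by (simp_all add: quotient_algebra_def)

lemma proj_eq_iff:
  assumes "x \<in> carrier A" "y \<in> carrier A"
  shows "proj x = proj y \<longleftrightarrow> x \<ominus> y \<in> I"
  using quotient_eq_iff_same_a_r_cos[OF I.ideal_axioms assms] by simp

lemma proj_zero: "proj \<zero> = I"
  using I.a_subset by simp

lemma proj_add:
  "\<lbrakk>x \<in> carrier A; y \<in> carrier A\<rbrakk> \<Longrightarrow> proj x \<oplus>\<^bsub>Q\<^esub> proj y = proj (x \<oplus> y)"
  by (simp add: Q_simps I.a_rcos_sum)

lemma proj_mult:
  "\<lbrakk>x \<in> carrier A; y \<in> carrier A\<rbrakk> \<Longrightarrow> proj x \<otimes>\<^bsub>Q\<^esub> proj y = proj (x \<otimes> y)"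
  by (simp add: Q_simps I.rcoset_mult_add)

lemma proj_scale:
  assumes x: "x \<in> carrier A"
  shows "c \<odot>\<^bsub>Q\<^esub> proj x = proj (c \<odot> x)"
proof -
  have "proj (c \<odot> y) = proj (c \<odot> x)" if "y \<in> proj x" for y
  proof -
    obtain i where i: "i \<in> I" "y = i \<oplus> x"
      using \<open>y \<in> proj x\<close> by (auto simp: a_r_coset_def')
    have "c \<odot> y \<ominus> c \<odot> x = (c \<odot> \<one>) \<otimes> i"
    proof -
      have "c \<odot> y = c \<odot> i \<oplus> c \<odot> x" using i x by (simp add: scale_add_right)
      moreover have "(c \<odot> i \<oplus> c \<odot> x) \<ominus> c \<odot> x = c \<odot> i"
        using scale_closed[of i c] scale_closed[of x c] i x by (simp add: minus_eq a_assoc r_neg)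
      ultimately show ?thesis using i by (simp add: scale_one_mult)
    qed
    then show ?thesis
      using i x by (simp add: proj_eq_iff scale_closed I.I_l_closed)
  qed
  moreover have "x \<in> proj x"
    using x I.zero_closed by (auto simp: a_r_coset_def' intro!: bexI[of _ \<zero>])
  ultimately have "(\<Union>y\<in>proj x. proj (c \<odot> y)) = proj (c \<odot> x)" by blast
  then show ?thesis by (simp add: quotient_algebra_def)
qed

lemma abelian_group_Q: "abelian_group Q"
proof (rule abelian_groupI)
  have zero: "\<zero>\<^bsub>Q\<^esub> = proj \<zero>" by (simp add: Q_simps proj_zero)
  show "\<zero>\<^bsub>Q\<^esub> \<in> carrier Q"
    unfolding carrier_Q zero by blast
  show "X \<oplus>\<^bsub>Q\<^esub> Y \<in> carrier Q" "X \<oplus>\<^bsub>Q\<^esub> Y = Y \<oplus>\<^bsub>Q\<^esub> X" if "X \<in> carrier Q" "Y \<in> carrier Q" for X Y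
    using that unfolding carrier_Q by (auto simp: proj_add a_comm)
  show "X \<oplus>\<^bsub>Q\<^esub> Y \<oplus>\<^bsub>Q\<^esub> Z = X \<oplus>\<^bsub>Q\<^esub> (Y \<oplus>\<^bsub>Q\<^esub> Z)"
    if "X \<in> carrier Q" "Y \<in> carrier Q" "Z \<in> carrier Q" for X Y Z
    using that unfolding carrier_Q by (auto simp: proj_add a_assoc)
  show "\<zero>\<^bsub>Q\<^esub> \<oplus>\<^bsub>Q\<^esub> X = X" if "X \<in> carrier Q" for X
    using that unfolding carrier_Q zero by (auto simp: proj_add simp del: a_coset_add_zero)
  show "\<exists>Y\<in>carrier Q. Y \<oplus>\<^bsub>Q\<^esub> X = \<zero>\<^bsub>Q\<^esub>" if "X \<in> carrier Q" for X
  proof -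
    obtain x where x: "x \<in> carrier A" "X = proj x" using \<open>X \<in> carrier Q\<close> unfolding carrier_Q by blast
    then have "proj (\<ominus> x) \<in> carrier Q" "proj (\<ominus> x) \<oplus>\<^bsub>Q\<^esub> X = \<zero>\<^bsub>Q\<^esub>"
      unfolding carrier_Q zero by (auto simp: proj_add l_neg simp del: a_coset_add_zero)
    then show ?thesis by blast
  qed
qed

sublocale Q: abelian_group Q by (rule abelian_group_Q)

lemma proj_minus:
  assumes "x \<in> carrier A"
  shows "\<ominus>\<^bsub>Q\<^esub> proj x = proj (\<ominus> x)"
  using assms by (intro Q.minus_equality) (auto simp: carrier_Q proj_add l_neg Q_simps(1) proj_zero)

lemma proj_diff:
  "\<lbrakk>x \<in> carrier A; y \<in> carrier A\<rbrakk> \<Longrightarrow> proj x \<ominus>\<^bsub>Q\<^esub> proj y = proj (x \<ominus> y)"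
  by (simp add: a_minus_def proj_minus proj_add)

lemma nrm_proj_less_iff:
  assumes x: "x \<in> carrier A"
  shows "nrm Q (proj x) < \<epsilon> \<longleftrightarrow> (\<exists>i\<in>I. nrm A (i \<oplus> x) < \<epsilon>)"
proof -
  have "bdd_below (nrm A ` proj x)"
    using x by (intro bdd_belowI[of _ 0]) (auto simp: a_r_coset_def' nrm_nonneg)
  moreover have "nrm A ` proj x \<noteq> {}"
    using I.zero_closed unfolding a_r_coset_def' by blast
  ultimately show ?thesis
    unfolding Q_simps by (subst cInf_less_iff) (auto simp: a_r_coset_def')
qed

lemma nrm_proj_le:
  assumes x: "x \<in> carrier A"
  shows "nrm Q (proj x) \<le> nrm A x"
proof (rule field_le_epsilon)
  fix \<epsilon> :: real assume "0 < \<epsilon>"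
  then have "nrm A (\<zero> \<oplus> x) < nrm A x + \<epsilon>" using x by simp
  then have "nrm Q (proj x) < nrm A x + \<epsilon>"
    unfolding nrm_proj_less_iff[OF x] using I.zero_closed by blast
  then show "nrm Q (proj x) \<le> nrm A x + \<epsilon>" by simp
qed

lemma nrm_proj_nonneg: "x \<in> carrier A \<Longrightarrow> 0 \<le> nrm Q (proj x)"
  unfolding not_less[symmetric] nrm_proj_less_iff by (auto simp: not_less nrm_nonneg)

lemma nrm_proj_eq_zero:
  assumes x: "x \<in> carrier A"
  shows "nrm Q (proj x) = 0 \<longleftrightarrow> x \<in> I"
proof
  assume zero: "nrm Q (proj x) = 0"
  show "x \<in> I"
  proof (rule closed_idealD(3)[OF I_closed x])
    fix \<epsilon> :: real assume "0 < \<epsilon>"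
    then obtain i where i: "i \<in> I" "nrm A (i \<oplus> x) < \<epsilon>"
      using nrm_proj_less_iff[OF x, of \<epsilon>] zero by auto
    have "x \<ominus> \<ominus> i = i \<oplus> x" using i x by (simp add: minus_eq a_comm)
    then show "\<exists>y\<in>I. nrm A (x \<ominus> y) < \<epsilon>"
      using i by (intro bexI[of _ "\<ominus> i"]) auto
  qed
next
  assume "x \<in> I"
  then have "nrm A (\<ominus> x \<oplus> x) = 0" using x nrm_eq_zero[of \<zero>] by (simp add: l_neg)
  then have "nrm Q (proj x) < \<epsilon>" if "0 < \<epsilon>" for \<epsilon>
    unfolding nrm_proj_less_iff[OF x] using \<open>x \<in> I\<close> that by (intro bexI[of _ "\<ominus> x"]) auto
  from this[of "nrm Q (proj x)"] show "nrm Q (proj x) = 0"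
    using nrm_proj_nonneg[OF x] by linarith
qed

lemma nrm_proj_triangle:
  assumes x: "x \<in> carrier A" and y: "y \<in> carrier A"
  shows "nrm Q (proj (x \<oplus> y)) \<le> nrm Q (proj x) + nrm Q (proj y)"
proof (rule field_le_epsilon)
  fix \<epsilon> :: real assume "0 < \<epsilon>"
  then obtain i j where ij: "i \<in> I" "nrm A (i \<oplus> x) < nrm Q (proj x) + \<epsilon> / 2"
    "j \<in> I" "nrm A (j \<oplus> y) < nrm Q (proj y) + \<epsilon> / 2"
    using nrm_proj_less_iff[OF x, of "nrm Q (proj x) + \<epsilon> / 2"]
      nrm_proj_less_iff[OF y, of "nrm Q (proj y) + \<epsilon> / 2"] by auto
  have c: "i \<in> carrier A" "j \<in> carrier A" using ij by auto
  have "(i \<oplus> j) \<oplus> (x \<oplus> y) = (i \<oplus> x) \<oplus> (j \<oplus> y)"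
    using c x y by algebra
  then have "nrm A ((i \<oplus> j) \<oplus> (x \<oplus> y)) < nrm Q (proj x) + nrm Q (proj y) + \<epsilon>"
    using nrm_triangle[of "i \<oplus> x" "j \<oplus> y"] c x y ij by simp
  then have "nrm Q (proj (x \<oplus> y)) < nrm Q (proj x) + nrm Q (proj y) + \<epsilon>"
    using nrm_proj_less_iff[of "x \<oplus> y"] x y ij by blast
  then show "nrm Q (proj (x \<oplus> y)) \<le> nrm Q (proj x) + nrm Q (proj y) + \<epsilon>" by simp
qed

lemma nrm_proj_minus:
  assumes x: "x \<in> carrier A"
  shows "nrm Q (proj (\<ominus> x)) = nrm Q (proj x)"
proof -
  have le: "nrm Q (proj (\<ominus> y)) \<le> nrm Q (proj y)" if y: "y \<in> carrier A" for y
  proof (rule field_le_epsilon)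
    fix \<epsilon> :: real assume "0 < \<epsilon>"
    then obtain i where i: "i \<in> I" "nrm A (i \<oplus> y) < nrm Q (proj y) + \<epsilon>"
      using nrm_proj_less_iff[OF y, of "nrm Q (proj y) + \<epsilon>"] by auto
    have "\<ominus> i \<oplus> \<ominus> y = \<ominus> (i \<oplus> y)" using i y by (simp add: minus_add)
    then have "nrm A (\<ominus> i \<oplus> \<ominus> y) < nrm Q (proj y) + \<epsilon>"
      using i y by (simp add: nrm_minus)
    then have "nrm Q (proj (\<ominus> y)) < nrm Q (proj y) + \<epsilon>"
      using nrm_proj_less_iff[of "\<ominus> y"] y i(1) by (metis I.a_inv_closed a_inv_closed)
    then show "nrm Q (proj (\<ominus> y)) \<le> nrm Q (proj y) + \<epsilon>" by simp
  qed
  show ?thesis using le[of x] le[of "\<ominus> x"] x by simp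
qed

lemma alg_dist_proj:
  "\<lbrakk>x \<in> carrier A; y \<in> carrier A\<rbrakk> \<Longrightarrow> alg_dist Q (proj x) (proj y) = nrm Q (proj (x \<ominus> y))"
  by (simp add: alg_dist_def carrier_Q proj_diff)

text \<open>The closed sets of the quotient are accessible only once its distance is known to be a metric.
  The separation axiom is where closedness of \<open>I\<close> enters, through \<open>nrm_proj_eq_zero\<close>.\<close>

sublocale Qm: Metric_space "carrier Q" "alg_dist Q"
proof
  have minus_swap: "y \<ominus> x = \<ominus> (x \<ominus> y)" if "x \<in> carrier A" "y \<in> carrier A" for x y
    using that by algebra
  have zero: "alg_dist Q X Y = 0" if "\<not> (X \<in> carrier Q \<and> Y \<in> carrier Q)" for X Y
    using that by (auto simp: alg_dist_def)
  show "0 \<le> alg_dist Q X Y" for X Y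
    by (cases "X \<in> carrier Q \<and> Y \<in> carrier Q")
      (auto simp: zero alg_dist_proj nrm_proj_nonneg carrier_Q)
  show "alg_dist Q X Y = alg_dist Q Y X" for X Y
  proof (cases "X \<in> carrier Q \<and> Y \<in> carrier Q")
    case True
    then obtain x y where "x \<in> carrier A" "y \<in> carrier A" "X = proj x" "Y = proj y"
      unfolding carrier_Q by blast
    then show ?thesis
      using minus_swap[of x y] by (simp add: alg_dist_proj nrm_proj_minus)
  qed (use zero in metis)
  show "alg_dist Q X Y = 0 \<longleftrightarrow> X = Y" if "X \<in> carrier Q" "Y \<in> carrier Q" for X Y
  proof -
    obtain x y where "x \<in> carrier A" "y \<in> carrier A" "X = proj x" "Y = proj y"
      using \<open>X \<in> carrier Q\<close> \<open>Y \<in> carrier Q\<close> unfolding carrier_Q by blast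
    then show ?thesis by (simp add: alg_dist_proj nrm_proj_eq_zero proj_eq_iff)
  qed
  show "alg_dist Q X Z \<le> alg_dist Q X Y + alg_dist Q Y Z"
    if "X \<in> carrier Q" "Y \<in> carrier Q" "Z \<in> carrier Q" for X Y Z
  proof -
    obtain x y z where xyz: "x \<in> carrier A" "y \<in> carrier A" "z \<in> carrier A"
      "X = proj x" "Y = proj y" "Z = proj z"
      using \<open>X \<in> carrier Q\<close> \<open>Y \<in> carrier Q\<close> \<open>Z \<in> carrier Q\<close> unfolding carrier_Q by blast
    then have "x \<ominus> z = (x \<ominus> y) \<oplus> (y \<ominus> z)" by algebra
    then show ?thesis
      using nrm_proj_triangle[of "x \<ominus> y" "y \<ominus> z"] xyz by (simp add: alg_dist_proj)
  qed
qed

text \<open>The preimage is closed because the projection does not increase norms.\<close>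

lemma closed_ideal_vimage_proj:
  assumes K: "K \<in> closed_ideals Q"
  defines "L \<equiv> {x \<in> carrier A. proj x \<in> K}"
  shows "L \<in> closed_ideals A" and "I \<subseteq> L" and "proj ` L = K"
proof -
  have sub: "additive_subgroup K Q"
    and mult: "\<And>X a. \<lbrakk>X \<in> K; a \<in> carrier Q\<rbrakk> \<Longrightarrow> a \<otimes>\<^bsub>Q\<^esub> X \<in> K \<and> X \<otimes>\<^bsub>Q\<^esub> a \<in> K"
    and closed: "closedin (norm_topology Q) K"
    using K unfolding closed_ideals_def closed_ideal_def by auto
  interpret K: additive_subgroup K Q by (rule sub)
  have "I \<in> K" using K.zero_closed by (simp add: Q_simps)
  show "I \<subseteq> L"
  proof
    fix i assume "i \<in> I"
    then have "proj i = proj \<zero>" by (simp add: proj_eq_iff minus_eq)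
    then show "i \<in> L" using \<open>I \<in> K\<close> \<open>i \<in> I\<close> by (simp add: L_def proj_zero)
  qed
  show "proj ` L = K"
    using K.a_subset unfolding L_def carrier_Q by auto
  have "ideal L A"
  proof (rule idealI[OF ring_axioms])
    show "subgroup L (add_monoid A)"
    proof (rule add.subgroupI)
      show "L \<noteq> {}" using \<open>I \<subseteq> L\<close> I.zero_closed by blast
      show "\<ominus> x \<in> L" if "x \<in> L" for x
        using that K.a_inv_closed[of "proj x"] by (simp add: L_def proj_minus)
      show "x \<oplus> y \<in> L" if "x \<in> L" "y \<in> L" for x y
        using that K.a_closed[of "proj x" "proj y"] by (simp add: L_def proj_add)
    qed (auto simp: L_def)
    show "x \<otimes> a \<in> L" "a \<otimes> x \<in> L" if "a \<in> L" "x \<in> carrier A" for a x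
      using that mult[of "proj a" "proj x"] by (simp_all add: L_def proj_mult carrier_Q)
  qed
  moreover have "closedin (norm_topology A) L"
    unfolding norm_topology_def closedin_metric
  proof (intro conjI allI impI)
    fix x assume "x \<in> carrier A - L"
    then have x: "x \<in> carrier A" "proj x \<in> carrier Q - K" by (auto simp: L_def carrier_Q)
    then obtain \<epsilon> where \<epsilon>: "0 < \<epsilon>" "disjnt K (Qm.mball (proj x) \<epsilon>)"
      using closed unfolding norm_topology_def Qm.closedin_metric by blast
    have "y \<notin> L" if "y \<in> mball x \<epsilon>" for y
    proof
      assume "y \<in> L"
      have y: "y \<in> carrier A" "nrm A (x \<ominus> y) < \<epsilon>"
        using that by (auto simp: alg_dist_def)
      then have "alg_dist Q (proj x) (proj y) < \<epsilon>"
        using nrm_proj_le[of "x \<ominus> y"] x by (simp add: alg_dist_proj)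
      moreover have "proj y \<in> K" "proj y \<in> carrier Q"
        using \<open>y \<in> L\<close> y by (simp_all add: L_def carrier_Q)
      ultimately show False
        using \<epsilon>(2) x(2) unfolding disjnt_iff Qm.in_mball by blast
    qed
    then show "\<exists>r>0. disjnt L (mball x r)"
      using \<epsilon>(1) by (auto simp: disjnt_iff intro!: exI[of _ \<epsilon>])
  qed (auto simp: L_def)
  ultimately show "L \<in> closed_ideals A" by (simp add: closed_ideal_iff)
qed

lemma proj_mem_image_iff:
  assumes L: "ideal L A" "I \<subseteq> L" and x: "x \<in> carrier A"
  shows "proj x \<in> proj ` L \<longleftrightarrow> x \<in> L"
proof
  interpret L: ideal L A by fact
  assume "proj x \<in> proj ` L"
  then obtain l where l: "l \<in> L" "x \<ominus> l \<in> I" using x by (auto simp: proj_eq_iff)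
  have "(x \<ominus> l) \<oplus> l = x" using x l(1) by (simp add: minus_eq a_assoc l_neg)
  then show "x \<in> L" using l L(2) L.a_closed by (metis subsetD)
qed blast

text \<open>Closedness uses \<open>I \<subseteq> L\<close>: a coset that contains an element of \<open>L\<close> lies in \<open>L\<close>, so the distance from
  \<open>proj x\<close> to the image of \<open>L\<close> is not smaller than the distance from \<open>x\<close> to \<open>L\<close>.\<close>

lemma closed_ideal_image_proj:
  assumes L: "L \<in> closed_ideals A" and IL: "I \<subseteq> L"
  shows "proj ` L \<in> closed_ideals Q"
proof -
  interpret L: ideal L A by (rule closed_idealD[OF L])
  note mem = proj_mem_image_iff[OF L.ideal_axioms IL]
  have "subgroup (proj ` L) (add_monoid Q)"
  proof (rule Q.add.subgroupI)
    show "proj ` L \<subseteq> carrier Q" using L.a_subset by (auto simp: carrier_Q)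
    show "proj ` L \<noteq> {}" using L.zero_closed by blast
    show "\<ominus>\<^bsub>Q\<^esub> X \<in> proj ` L" if "X \<in> proj ` L" for X
      using that by (auto simp: proj_minus)
    show "X \<oplus>\<^bsub>Q\<^esub> Y \<in> proj ` L" if "X \<in> proj ` L" "Y \<in> proj ` L" for X Y
      using that by (auto simp: proj_add)
  qed
  then have "additive_subgroup (proj ` L) Q" by (rule additive_subgroupI)
  moreover have "c \<odot>\<^bsub>Q\<^esub> X \<in> proj ` L" if "X \<in> proj ` L" for c X
  proof -
    obtain l where l: "l \<in> L" "X = proj l" using \<open>X \<in> proj ` L\<close> by blast
    then have "c \<odot> l \<in> L"
      using L.I_l_closed[of l "c \<odot> \<one>"] by (simp add: scale_one_mult scale_closed)
    then show ?thesis using l by (simp add: proj_scale)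
  qed
  moreover have "a \<otimes>\<^bsub>Q\<^esub> X \<in> proj ` L \<and> X \<otimes>\<^bsub>Q\<^esub> a \<in> proj ` L"
    if "X \<in> proj ` L" "a \<in> carrier Q" for X a
    using that by (auto simp: carrier_Q proj_mult L.I_l_closed L.I_r_closed)
  moreover have "closedin (norm_topology Q) (proj ` L)"
    unfolding norm_topology_def Qm.closedin_metric
  proof (intro conjI allI impI)
    show "proj ` L \<subseteq> carrier Q" using L.a_subset by (auto simp: carrier_Q)
    fix X assume "X \<in> carrier Q - proj ` L"
    then obtain x where x: "x \<in> carrier A" "X = proj x" "x \<notin> L" by (auto simp: carrier_Q)
    have "\<not> (\<forall>\<epsilon>>0. \<exists>y\<in>L. nrm A (x \<ominus> y) < \<epsilon>)"
      using closed_idealD(3)[OF L x(1)] x(3) by blast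
    then obtain \<epsilon> where \<epsilon>: "0 < \<epsilon>" "\<And>y. y \<in> L \<Longrightarrow> \<epsilon> \<le> nrm A (x \<ominus> y)"
      by (auto simp: not_less)
    have "proj l \<notin> Qm.mball X \<epsilon>" if l: "l \<in> L" for l
    proof
      assume "proj l \<in> Qm.mball X \<epsilon>"
      then have "nrm Q (proj (x \<ominus> l)) < \<epsilon>"
        using x l by (simp add: alg_dist_proj)
      then obtain i where i: "i \<in> I" "nrm A (i \<oplus> (x \<ominus> l)) < \<epsilon>"
        using nrm_proj_less_iff x l by auto
      have "i \<oplus> (x \<ominus> l) = x \<ominus> (l \<ominus> i)"
        using x(1) L.a_Hcarr[OF l] I.a_Hcarr[OF i(1)] by algebra
      moreover have "l \<ominus> i \<in> L" using l i IL by (auto simp: minus_eq)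
      ultimately show False using \<epsilon>(2) i by fastforce
    qed
    then show "\<exists>r>0. disjnt (proj ` L) (Qm.mball X r)"
      using \<epsilon>(1) by (intro exI[of _ \<epsilon>]) (auto simp: disjnt_iff)
  qed
  ultimately show ?thesis
    unfolding closed_ideals_def closed_ideal_def by blast
qed

lemma proj_image_eq_carrier_iff:
  assumes "ideal L A" "I \<subseteq> L"
  shows "proj ` L = carrier Q \<longleftrightarrow> L = carrier A"
  using proj_mem_image_iff[OF assms] additive_subgroup.a_subset[OF ideal.axioms(1)[OF assms(1)]]
  unfolding carrier_Q by blast

lemma proj_image_add:
  assumes "J \<subseteq> carrier A" "L \<subseteq> carrier A"
  shows "proj ` J <+>\<^bsub>Q\<^esub> proj ` L = proj ` (J <+> L)"
proof -
  have "proj x \<oplus>\<^bsub>Q\<^esub> proj y = proj (x \<oplus> y)" if "x \<in> J" "y \<in> L" for x y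
    using that assms by (intro proj_add) auto
  then show ?thesis
    unfolding set_add_def' by (auto simp: image_iff)
qed

text \<open>If \<open>I\<close> is the whole algebra, the quotient is zero and falls under the separate clause of
  \<open>small_ideal\<close>; the right-hand side then holds because \<open>L \<supseteq> I\<close> forces \<open>L = A\<close>.\<close>

lemma small_ideal_image_proj_iff:
  assumes J: "J \<in> closed_ideals A" and IJ: "I \<subseteq> J"
  shows "small_ideal (proj ` J) Q \<longleftrightarrow>
    (\<forall>L\<in>closed_ideals A. I \<subseteq> L \<longrightarrow> J <+> L = carrier A \<longrightarrow> L = carrier A)"
proof -
  note J' = closed_idealD[OF J]
  interpret J: ideal J A by (rule J')
  have all_iff: "(\<forall>K\<in>closed_ideals Q. K \<noteq> carrier Q \<longrightarrow> proj ` J <+>\<^bsub>Q\<^esub> K \<noteq> carrier Q) \<longleftrightarrow>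
    (\<forall>L\<in>closed_ideals A. I \<subseteq> L \<longrightarrow> J <+> L = carrier A \<longrightarrow> L = carrier A)"
  proof -
    have step: "(proj ` J <+>\<^bsub>Q\<^esub> proj ` L = carrier Q \<longleftrightarrow> J <+> L = carrier A) \<and>
        (proj ` L = carrier Q \<longleftrightarrow> L = carrier A)"
      if L: "L \<in> closed_ideals A" "I \<subseteq> L" for L
    proof -
      note L' = closed_idealD[OF L(1)]
      have "I \<subseteq> J <+> L"
      proof
        fix i assume i: "i \<in> I"
        then have "i = \<zero> \<oplus> i" by simp
        then show "i \<in> J <+> L"
          unfolding set_add_iff using i L(2) J.zero_closed by blast
      qed
      then show ?thesis
        using proj_image_eq_carrier_iff L L' J' proj_image_add add_ideals by simp
    qed
    have "closed_ideals Q = (`) proj ` {L \<in> closed_ideals A. I \<subseteq> L}"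
    proof
      show "closed_ideals Q \<subseteq> (`) proj ` {L \<in> closed_ideals A. I \<subseteq> L}"
        using closed_ideal_vimage_proj by (metis (no_types, lifting) image_eqI mem_Collect_eq subsetI)
    qed (use closed_ideal_image_proj in blast)
    then show ?thesis using step by auto
  qed
  have JQ: "proj ` J \<in> closed_ideals Q"
    using closed_ideal_image_proj J IJ by simp
  show ?thesis
  proof (cases "carrier Q = {\<zero>\<^bsub>Q\<^esub>}")
    case True
    \<comment> \<open>the quotient vanishes, that is, \<open>I\<close> is the whole algebra\<close>
    have "proj ` J \<subseteq> carrier Q" "proj ` J \<noteq> {}"
      using J'(2) J.zero_closed unfolding carrier_Q by blast+
    then have "proj ` J = {\<zero>\<^bsub>Q\<^esub>}" using True by blast
    moreover have "L = carrier A" if L: "L \<in> closed_ideals A" "I \<subseteq> L" for L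
    proof -
      have "x \<in> I" if "x \<in> carrier A" for x
        using True that proj_eq_iff[of x \<zero>] unfolding carrier_Q
        by (auto simp: Q_simps proj_zero minus_eq)
      then show ?thesis using L closed_idealD(2)[OF L(1)] by blast
    qed
    ultimately show ?thesis using True JQ by (auto simp: small_ideal_def)
  next
    case False
    then show ?thesis using JQ all_iff by (simp add: small_ideal_def)
  qed
qed

end

context unital_cstar_algebra
begin

theorem sm_rel_iff:
  "(I, J) \<in> sm_rel A \<longleftrightarrow>
    I \<in> closed_ideals A \<and> J \<in> closed_ideals A \<and> I \<subseteq> J \<and>
    (\<forall>L\<in>closed_ideals A. I \<subseteq> L \<longrightarrow> J <+> L = carrier A \<longrightarrow> L = carrier A)"
proof (cases "I \<in> closed_ideals A \<and> J \<in> closed_ideals A \<and> I \<subseteq> J")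
  case True
  then interpret closed_ideal_quotient A I
    using closed_idealD(1) unital_cstar_algebra_axioms
    by (simp add: closed_ideal_quotient_def closed_ideal_quotient_axioms_def)
  show ?thesis
    using True small_ideal_image_proj_iff[of J] by (auto simp: sm_rel_def)
qed (auto simp: sm_rel_def)

section \<open>Smallness as an R-order\<close>

lemma sm_relD:
  assumes "(I, J) \<in> sm_rel A"
  shows "I \<in> closed_ideals A" "J \<in> closed_ideals A" "I \<subseteq> J"
    and "\<lbrakk>L \<in> closed_ideals A; I \<subseteq> L; J <+> L = carrier A\<rbrakk> \<Longrightarrow> L = carrier A"
  using assms unfolding sm_rel_iff by blast+

lemma set_add_mono: "L \<subseteq> M \<Longrightarrow> K <+> L \<subseteq> K <+> M"
  unfolding subset_iff set_add_iff by blast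

lemma subset_add:
  assumes "ideal I A" "ideal K A"
  shows "I \<subseteq> I <+> K" "K \<subseteq> I <+> K"
proof -
  interpret I: ideal I A by fact
  interpret K: ideal K A by fact
  show "I \<subseteq> I <+> K"
  proof
    fix x assume x: "x \<in> I"
    then have "x = x \<oplus> \<zero>" by simp
    then show "x \<in> I <+> K" unfolding set_add_iff using x K.zero_closed by blast
  qed
  show "K \<subseteq> I <+> K"
  proof
    fix x assume x: "x \<in> K"
    then have "x = \<zero> \<oplus> x" by simp
    then show "x \<in> I <+> K" unfolding set_add_iff using x I.zero_closed by blast
  qed
qed

lemma add_absorb:
  assumes "ideal I A" "ideal K A" "I \<subseteq> K"
  shows "I <+> K = K"
proof
  interpret K: ideal K A by fact
  show "I <+> K \<subseteq> K" using assms(3) by (auto simp: set_add_iff intro!: K.a_closed)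
qed (rule subset_add(2)[OF assms(1,2)])

lemma add_assoc_ideals:
  assumes "I \<subseteq> carrier A" "J \<subseteq> carrier A" "K \<subseteq> carrier A"
  shows "(I <+> J) <+> K = I <+> (J <+> K)"
  using add.set_mult_assoc[OF assms] by (simp add: set_add_def)

text \<open>If \<open>L \<supseteq> K \<supseteq> I\<close>, then \<open>(J + K) + L = J + L\<close>, so the condition for \<open>K\<close> and \<open>J + K\<close> is the condition
  for \<open>I\<close> and \<open>J\<close>, restricted to fewer ideals \<open>L\<close>.\<close>

lemma H_relation_sm_rel: "H_relation A (sm_rel A)"
  unfolding H_relation_def
proof (intro conjI)
  show "sm_rel A \<subseteq> closed_ideals A \<times> closed_ideals A" "\<forall>(I, J)\<in>sm_rel A. I \<subseteq> J"
    by (auto simp: sm_rel_def)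
  show "refl_on (closed_ideals A) (sm_rel A)"
    by (auto simp: refl_on_def sm_rel_iff add_absorb closed_idealD(1))
  show "\<forall>(I, J)\<in>sm_rel A. \<forall>K\<in>closed_ideals A. I \<subseteq> K \<longrightarrow> (K, J <+> K) \<in> sm_rel A"
  proof clarify
    fix I J K assume IJ: "(I, J) \<in> sm_rel A" and K: "K \<in> closed_ideals A" "I \<subseteq> K"
    then have J: "J \<in> closed_ideals A" by (simp add: sm_rel_iff)
    have "L = carrier A" if L: "L \<in> closed_ideals A" "K \<subseteq> L" "(J <+> K) <+> L = carrier A" for L
    proof -
      have "(J <+> K) <+> L = J <+> L"
        using L K J by (simp add: add_assoc_ideals closed_idealD add_absorb)
      then show ?thesis
        using L K IJ by (auto simp: sm_rel_iff)
    qed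
    then show "(K, J <+> K) \<in> sm_rel A"
      unfolding sm_rel_iff
      using J K add_closed_ideals[OF J K(1)] subset_add(2)[of J K] closed_idealD(1) by simp
  qed
qed

text \<open>The closed ideal \<open>J + L\<close> serves as the test ideal for the pair \<open>J\<close>, \<open>K\<close>.\<close>

lemma trans_sm_rel: "trans (sm_rel A)"
proof (rule transI)
  fix I J K assume IJ: "(I, J) \<in> sm_rel A" and JK: "(J, K) \<in> sm_rel A"
  have J: "J \<in> closed_ideals A" and K: "K \<in> closed_ideals A" "J \<subseteq> K"
    using IJ JK by (simp_all add: sm_rel_iff)
  have "L = carrier A" if L: "L \<in> closed_ideals A" "I \<subseteq> L" "K <+> L = carrier A" for L
  proof -
    have JL: "J <+> L \<in> closed_ideals A" "J \<subseteq> J <+> L"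
      using add_closed_ideals[OF J L(1)] subset_add(1)[of J L] J L closed_idealD(1) by simp_all
    have "K <+> L \<subseteq> K <+> (J <+> L)"
      using set_add_mono subset_add(2) closed_idealD(1) J L(1) by blast
    moreover have "K <+> (J <+> L) \<subseteq> carrier A"
      using closed_idealD(2)[OF add_closed_ideals[OF K(1) JL(1)]] .
    ultimately have "K <+> (J <+> L) = carrier A" using L(3) by blast
    then have "J <+> L = carrier A" using JK JL by (simp add: sm_rel_iff)
    then show ?thesis using IJ L by (simp add: sm_rel_iff)
  qed
  then show "(I, K) \<in> sm_rel A"
    using IJ JK by (auto simp: sm_rel_iff)
qed

lemma algebraic_sumE:
  assumes "x \<in> algebraic_sum A G"
  obtains F f where "finite F" "F \<subseteq> G" "\<forall>J\<in>F. f J \<in> J" "x = finsum A f F"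
  using assms unfolding algebraic_sum_def by blast

lemma algebraic_sumI:
  assumes "finite F" "F \<subseteq> G" "\<And>J. J \<in> F \<Longrightarrow> f J \<in> J"
  shows "finsum A f F \<in> algebraic_sum A G"
  using assms unfolding algebraic_sum_def by blast

lemma algebraic_sum_subset:
  assumes "ideal K A" "\<And>J. J \<in> G \<Longrightarrow> J \<subseteq> K"
  shows "algebraic_sum A G \<subseteq> K"
proof
  interpret K: ideal K A by fact
  have sum: "finsum A f F \<in> K" if "finite F" "\<And>J. J \<in> F \<Longrightarrow> f J \<in> K"
    for f :: "'a set \<Rightarrow> 'a" and F
    using that
  proof (induction F)
    case (insert J F)
    have "f \<in> F \<rightarrow> carrier A" "f J \<in> carrier A" using insert.prems by auto
    then have "finsum A f (insert J F) = f J \<oplus> finsum A f F"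
      using insert.hyps by (simp add: finsum_insert)
    then show ?case using insert.IH insert.prems K.a_closed by simp
  qed simp
  fix x assume "x \<in> algebraic_sum A G"
  then obtain F f where F: "finite F" "F \<subseteq> G" "\<forall>J\<in>F. f J \<in> J" "x = finsum A f F"
    by (rule algebraic_sumE)
  have "f J \<in> K" if "J \<in> F" for J
    using F(2,3) assms(2) that by blast
  then show "x \<in> K" unfolding F(4) by (rule sum[OF F(1)])
qed

lemma subset_algebraic_sum:
  assumes "J \<in> G" "J \<subseteq> carrier A"
  shows "J \<subseteq> algebraic_sum A G"
proof
  fix x assume x: "x \<in> J"
  have "finsum A (\<lambda>_. x) {J} \<in> algebraic_sum A G"
    using x assms(1) by (intro algebraic_sumI) auto
  moreover have "finsum A (\<lambda>_. x) {J} = x"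
    using x assms(2) by (subst finsum_insert) auto
  ultimately show "x \<in> algebraic_sum A G" by simp
qed

text \<open>Two finite sums over different finite subfamilies are added by extending both with zeros to the
  union of the subfamilies.\<close>

lemma ideal_algebraic_sum:
  assumes G: "\<And>J. J \<in> G \<Longrightarrow> ideal J A"
  shows "ideal (algebraic_sum A G) A"
proof (rule idealI[OF ring_axioms])
  let ?S = "algebraic_sum A G"
  have sub: "J \<subseteq> carrier A" if "J \<in> G" for J
    using G[OF that] additive_subgroup.a_subset ideal.axioms(1) by blast
  have map: "T (finsum A f F) = finsum A (\<lambda>J. T (f J)) F"
    if "finite F" "f \<in> F \<rightarrow> carrier A" "T \<in> carrier A \<rightarrow> carrier A" "T \<zero> = \<zero>"
      "\<And>x y. \<lbrakk>x \<in> carrier A; y \<in> carrier A\<rbrakk> \<Longrightarrow> T (x \<oplus> y) = T x \<oplus> T y"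
    for T and f :: "'a set \<Rightarrow> 'a" and F
    using that
  proof (induction F)
    case (insert J F)
    then have "f \<in> F \<rightarrow> carrier A" "f J \<in> carrier A" "(\<lambda>J. T (f J)) \<in> F \<rightarrow> carrier A" by auto
    with insert show ?case by (simp add: finsum_insert Pi_iff)
  qed simp
  have additive: "T x \<in> ?S"
    if x: "x \<in> ?S" and T: "T \<in> carrier A \<rightarrow> carrier A" "T \<zero> = \<zero>"
      "\<And>x y. \<lbrakk>x \<in> carrier A; y \<in> carrier A\<rbrakk> \<Longrightarrow> T (x \<oplus> y) = T x \<oplus> T y"
      "\<And>J x. \<lbrakk>J \<in> G; x \<in> J\<rbrakk> \<Longrightarrow> T x \<in> J" for T x
  proof -
    obtain F f where F: "finite F" "F \<subseteq> G" "\<forall>J\<in>F. f J \<in> J" "x = finsum A f F"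
      using x by (rule algebraic_sumE)
    have "f \<in> F \<rightarrow> carrier A" using F sub by blast
    then have "T x = finsum A (\<lambda>J. T (f J)) F"
      unfolding F(4) by (rule map[OF F(1) _ T(1,2,3)])
    moreover have "finsum A (\<lambda>J. T (f J)) F \<in> ?S"
      using F(1,2,3) T(4) by (intro algebraic_sumI) auto
    ultimately show ?thesis by simp
  qed
  have S_sub: "?S \<subseteq> carrier A"
    using algebraic_sum_subset[OF oneideal sub] .
  show "subgroup ?S (add_monoid A)"
  proof (rule add.subgroupI)
    show "?S \<subseteq> carrier A" by (rule S_sub)
    show "?S \<noteq> {}" using algebraic_sumI[of "{}"] by auto
    show "\<ominus> x \<in> ?S" if "x \<in> ?S" for x
    proof (rule additive[OF that])
      show "\<ominus> y \<in> J" if "J \<in> G" "y \<in> J" for J y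
        using additive_subgroup.a_inv_closed[OF ideal.axioms(1)[OF G[OF that(1)]]] that by simp
    qed (auto simp: minus_add)
    show "x \<oplus> y \<in> ?S" if x: "x \<in> ?S" and y: "y \<in> ?S" for x y
    proof -
      obtain F f where F: "finite F" "F \<subseteq> G" "\<forall>J\<in>F. f J \<in> J" "x = finsum A f F"
        using x by (rule algebraic_sumE)
      obtain E e where E: "finite E" "E \<subseteq> G" "\<forall>J\<in>E. e J \<in> J" "y = finsum A e E"
        using y by (rule algebraic_sumE)
      have extend: "\<exists>d. (\<forall>J\<in>D'. d J \<in> J) \<and> finsum A d D' = finsum A c D"
        if D: "D \<subseteq> D'" "finite D'" "D' \<subseteq> G" "\<And>J. J \<in> D \<Longrightarrow> c J \<in> J" for D D' c
      proof (intro exI conjI ballI)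
        let ?d = "\<lambda>J. if J \<in> D then c J else \<zero>"
        show "?d J \<in> J" if "J \<in> D'" for J
          using that D additive_subgroup.zero_closed[OF ideal.axioms(1)[OF G]] by auto
        have c: "c J \<in> carrier A" if "J \<in> D" for J
          using D(1,3) D(4)[OF that] sub that by blast
        show "finsum A ?d D' = finsum A c D"
        proof (rule add.finprod_mono_neutral_cong_right[OF D(2,1)])
          show "?d \<in> D' \<rightarrow> carrier A" using c by simp
        qed simp_all
      qed
      have FE: "finite (F \<union> E)" "F \<union> E \<subseteq> G"
        using F(1,2) E(1,2) by auto
      obtain f' where f': "\<forall>J\<in>F \<union> E. f' J \<in> J" "finsum A f' (F \<union> E) = x"
        using extend[OF Un_upper1 FE, of f] F(3) unfolding F(4) by blast
      obtain e' where e': "\<forall>J\<in>F \<union> E. e' J \<in> J" "finsum A e' (F \<union> E) = y"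
        using extend[OF Un_upper2 FE, of e] E(3) unfolding E(4) by blast
      have "f' \<in> F \<union> E \<rightarrow> carrier A" "e' \<in> F \<union> E \<rightarrow> carrier A"
        using f'(1) e'(1) sub FE(2) by blast+
      then have "x \<oplus> y = (\<Oplus>J\<in>F \<union> E. f' J \<oplus> e' J)"
        unfolding f'(2)[symmetric] e'(2)[symmetric] by (rule finsum_addf[symmetric])
      also have "\<dots> \<in> ?S"
      proof (rule algebraic_sumI)
        show "f' J \<oplus> e' J \<in> J" if "J \<in> F \<union> E" for J
        proof -
          have "J \<in> G" using FE(2) that by blast
          then interpret J: ideal J A by (rule G)
          show ?thesis using f'(1) e'(1) that by (simp add: J.a_closed)
        qed
      qed (use FE in simp_all)
      finally show ?thesis .
    qed
  qed
  fix a x assume a: "a \<in> ?S" and x: "x \<in> carrier A"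
  show "x \<otimes> a \<in> ?S"
    by (rule additive[OF a, of "\<lambda>y. x \<otimes> y"]) (auto simp: r_distr x G ideal.I_l_closed)
  show "a \<otimes> x \<in> ?S"
    by (rule additive[OF a, of "\<lambda>y. y \<otimes> x"]) (auto simp: l_distr x G ideal.I_r_closed)
qed

text \<open>If a finite sum of elements of the ideals \<open>J\<close>, plus an element of \<open>L\<close>, is invertible, then these
  ideals and \<open>L\<close> together sum to \<open>A\<close>.  The induction moves one \<open>J\<close> at a time into \<open>L\<close>; once
  \<open>J + L = A\<close> is known, \<open>I \<ll> J\<close> yields \<open>L = A\<close>.  Invertible elements are used instead of \<open>1\<close> because
  that is what approximation of \<open>1\<close> provides.\<close>

lemma sm_rel_finite_sum:
  assumes "finite F" "\<And>J. J \<in> F \<Longrightarrow> (I, J) \<in> sm_rel A" "\<And>J. J \<in> F \<Longrightarrow> f J \<in> J"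
    and "L \<in> closed_ideals A" "I \<subseteq> L" "l \<in> L" "finsum A f F \<oplus> l \<in> Units A"
  shows "L = carrier A"
  using assms
proof (induction F arbitrary: L l)
  case empty
  interpret L: ideal L A using closed_idealD(1)[OF empty.prems(3)] .
  have "l \<in> Units A" using empty.prems(5,6) L.a_Hcarr by simp
  then have "inv l \<otimes> l = \<one>" "inv l \<in> carrier A" by simp_all
  with L.I_l_closed[OF empty.prems(5), of "inv l"] have "\<one> \<in> L" by simp
  then show ?case by (rule L.one_imp_carrier)
next
  case (insert J F)
  have IJ: "(I, J) \<in> sm_rel A" using insert.prems by simp
  then have J: "J \<in> closed_ideals A" by (rule sm_relD)
  have L: "L \<in> closed_ideals A" "I \<subseteq> L" "l \<in> L" by (fact insert.prems)+
  have JL: "J <+> L \<in> closed_ideals A" "I \<subseteq> J <+> L"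
    using add_closed_ideals[OF J L(1)] L(2)
      subset_add(2)[OF closed_idealD(1)[OF J] closed_idealD(1)[OF L(1)]] by simp_all
  have "f K \<in> carrier A" if "K \<in> insert J F" for K
    using closed_idealD(2)[OF sm_relD(2)[OF insert.prems(1)[OF that]]]
      insert.prems(2)[OF that] by (rule subsetD)
  then have f: "f \<in> F \<rightarrow> carrier A" "f J \<in> carrier A"
    by simp_all
  have fJ: "f J \<in> J" using insert.prems(2) by simp
  have sum: "f J \<oplus> l \<in> J <+> L" unfolding set_add_iff using fJ L(3) by blast
  have lc: "l \<in> carrier A" using L closed_idealD(2) by blast
  have "finsum A f (insert J F) \<oplus> l = finsum A f F \<oplus> (f J \<oplus> l)"
    using insert.hyps f lc by (simp add: finsum_insert a_ac)
  then have unit: "finsum A f F \<oplus> (f J \<oplus> l) \<in> Units A" using insert.prems(6) by simp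
  have "(I, K) \<in> sm_rel A" "f K \<in> K" if "K \<in> F" for K
    using insert.prems(1,2)[of K] that by simp_all
  from insert.IH[OF this JL sum unit] have "J <+> L = carrier A" .
  then show ?case by (rule sm_relD(4)[OF IJ L(1,2)])
qed

text \<open>A decomposition \<open>1 = y + l\<close> survives the replacement of \<open>y\<close> by a nearby \<open>s\<close> of the algebraic sum,
  with \<open>1\<close> replaced by the invertible element \<open>1 - (y - s)\<close>.\<close>

lemma sm_rel_ideal_sup:
  assumes ne: "G \<noteq> {}" and G: "\<And>J. J \<in> G \<Longrightarrow> (I, J) \<in> sm_rel A"
  shows "(I, ideal_sup A G) \<in> sm_rel A"
proof -
  have Gc: "J \<in> closed_ideals A" if "J \<in> G" for J
    using G[OF that] by (rule sm_relD)
  have sum: "ideal (algebraic_sum A G) A"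
    using ideal_algebraic_sum Gc closed_idealD(1) by blast
  have sub: "algebraic_sum A G \<subseteq> carrier A"
    using additive_subgroup.a_subset ideal.axioms(1) sum by blast
  have S: "ideal_sup A G \<in> closed_ideals A"
    unfolding ideal_sup_def using closure_of_ideal[OF sum] .
  have "algebraic_sum A G \<subseteq> ideal_sup A G"
    unfolding ideal_sup_def using sub by (intro closure_of_subset) (simp add: norm_topology_def)
  moreover obtain J where "J \<in> G" using ne by blast
  moreover have "I \<subseteq> J" "J \<subseteq> algebraic_sum A G"
    using G[OF \<open>J \<in> G\<close>] subset_algebraic_sum[OF \<open>J \<in> G\<close>] closed_idealD(2)[OF Gc[OF \<open>J \<in> G\<close>]]
    using sm_relD(3) by blast+
  ultimately have "I \<subseteq> ideal_sup A G" by blast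
  moreover have "L = carrier A"
    if L: "L \<in> closed_ideals A" "I \<subseteq> L" "ideal_sup A G <+> L = carrier A" for L
  proof -
    have "\<one> \<in> ideal_sup A G <+> L" using L(3) by simp
    then obtain y l where yl: "y \<in> ideal_sup A G" "l \<in> L" "\<one> = y \<oplus> l"
      unfolding set_add_iff by blast
    have "y \<in> carrier A" and "\<forall>\<epsilon>>0. \<exists>s\<in>algebraic_sum A G. nrm A (y \<ominus> s) < \<epsilon>"
      using yl(1) unfolding ideal_sup_def closure_of_norm_topology[OF sub] by blast+
    then obtain s where s: "s \<in> algebraic_sum A G" "nrm A (y \<ominus> s) < 1"
      using zero_less_one by blast
    have c: "y \<in> carrier A" "s \<in> carrier A" "l \<in> carrier A"
      using \<open>y \<in> carrier A\<close> s sub yl closed_idealD(2)[OF L(1)] by blast+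
    have "\<one> \<ominus> (y \<ominus> s) \<in> Units A"
      using Units_one_minus s c by simp
    moreover have "\<one> \<ominus> (y \<ominus> s) = s \<oplus> l"
      unfolding yl(3) using c by algebra
    moreover obtain F f
      where F: "finite F" "F \<subseteq> G" "\<forall>J\<in>F. f J \<in> J" "s = finsum A f F"
      using s(1) by (rule algebraic_sumE)
    ultimately have "finsum A f F \<oplus> l \<in> Units A" by simp
    from sm_rel_finite_sum[OF F(1) _ _ L(1,2) yl(2) this] F(2,3) G show ?thesis by blast
  qed
  moreover have "I \<in> closed_ideals A"
    using G[OF \<open>J \<in> G\<close>] by (rule sm_relD)
  ultimately show ?thesis
    unfolding sm_rel_iff using S by blast
qed

theorem R_order_sm_rel: "R_order A (sm_rel A)"
  unfolding R_order_def
proof (intro conjI ballI allI impI)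
  fix I G assume G: "G \<noteq> {} \<and> G \<subseteq> {J. (I, J) \<in> sm_rel A}"
  have "(I, ideal_sup A G) \<in> sm_rel A"
    by (rule sm_rel_ideal_sup) (use G in blast)+
  then show "ideal_sup A G \<in> {J. (I, J) \<in> sm_rel A}" by simp
qed (fact H_relation_sm_rel trans_sm_rel)+

section \<open>Transfinite closures\<close>

text \<open>Transfinite induction shows that every member of the chain is related to its first member.  At a
  limit, the closure of the union of the earlier members is their supremum: it is a closed ideal
  that contains all of them, and their supremum contains their union and is closed.\<close>

lemma R_order_transfinite_closure_subset:
  assumes R: "R_order A R"
  shows "transfinite_closure A R \<subseteq> R"
proof clarify
  fix I J assume "(I, J) \<in> transfinite_closure A R"
  then obtain r :: "'a set rel" and F where fam: "transfinite_family A R r F I J"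
    unfolding transfinite_closure_def by blast
  have refl: "refl_on (closed_ideals A) R" and trans: "trans R"
    using R by (simp_all add: R_order_def H_relation_def)
  have sup: "(I, ideal_sup A G) \<in> R"
    if "I \<in> closed_ideals A" "G \<noteq> {}" "\<And>J. J \<in> G \<Longrightarrow> (I, J) \<in> R" for G
    using R that unfolding R_order_def by blast
  have wo: "Well_order r"
    and Fc: "\<And>a. a \<in> Field r \<Longrightarrow> F a \<in> closed_ideals A"
    and suc: "\<And>a b. \<lbrakk>a \<in> Field r; b \<in> Field r; underS r b = under r a\<rbrakk> \<Longrightarrow> (F a, F b) \<in> R"
    and lim: "\<And>b. \<lbrakk>b \<in> Field r; underS r b \<noteq> {}; \<And>a. a \<in> Field r \<Longrightarrow> underS r b \<noteq> under r a\<rbrakk> \<Longrightarrow>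
        F b = norm_topology A closure_of (\<Union>a\<in>underS r b. F a)"
    using fam unfolding transfinite_family_def by blast+
  obtain z g where z: "z \<in> Field r" "underS r z = {}" "F z = I"
    and g: "g \<in> Field r" "F g = J"
    using fam unfolding transfinite_family_def by blast
  have "Refl r" "Total r" and wf: "wf (r - Id)"
    using wo by (simp_all add: order_on_defs well_order_on_def)
  have I: "I \<in> closed_ideals A" using Fc z by blast
  have "b \<in> Field r \<longrightarrow> (I, F b) \<in> R" for b
  proof (induction b rule: wf_induct_rule[OF wf])
    case (1 b)
    show ?case
    proof
      assume b: "b \<in> Field r"
      have IH: "a \<in> Field r \<and> (I, F a) \<in> R" if "a \<in> underS r b" for a
        using 1 that unfolding underS_def Field_def by blast
      consider "underS r b = {}" | a where "a \<in> Field r" "underS r b = under r a"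
        | "underS r b \<noteq> {}" "\<And>a. a \<in> Field r \<Longrightarrow> underS r b \<noteq> under r a" by blast
      then show "(I, F b) \<in> R"
      proof cases
        case 1
        have "(z, b) \<notin> r \<or> z = b" "(b, z) \<notin> r \<or> z = b"
          using 1 z(2) by (auto simp: underS_def)
        moreover have "(z, b) \<in> r \<or> (b, z) \<in> r \<or> z = b"
          using \<open>Total r\<close> b z(1) by (auto simp: total_on_def)
        ultimately have "b = z" by blast
        then show ?thesis using z I refl by (simp add: refl_on_def)
      next
        case 2
        then have "a \<in> underS r b"
          using \<open>Refl r\<close> unfolding under_def refl_on_def by blast
        then show ?thesis
          using IH suc[OF 2(1) b 2(2)] transD[OF trans] by blast
      next
        case 3
        let ?G = "F ` underS r b"
        have sup_R: "(I, ideal_sup A ?G) \<in> R"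
          by (rule sup[OF I]) (use 3(1) IH in blast)+
        have G: "K \<in> closed_ideals A" if "K \<in> ?G" for K
          using that IH Fc by blast
        have G_sub: "\<Union>?G \<subseteq> carrier A"
          using closed_idealD(2)[OF G] by (rule Union_least)
        have Fb: "F b = norm_topology A closure_of \<Union>?G"
          using lim[OF b 3] by simp
        have "\<Union>?G \<subseteq> algebraic_sum A ?G"
          by (rule Union_least, rule subset_algebraic_sum) (simp_all add: closed_idealD(2)[OF G])
        then have "F b \<subseteq> ideal_sup A ?G"
          unfolding Fb ideal_sup_def by (rule closure_of_mono)
        moreover have "ideal_sup A ?G \<subseteq> F b"
        proof -
          have "\<Union>?G \<subseteq> F b"
            unfolding Fb using G_sub by (intro closure_of_subset) (simp add: norm_topology_def)
          then have "algebraic_sum A ?G \<subseteq> F b"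
            using closed_idealD(1)[OF Fc[OF b]] by (intro algebraic_sum_subset) auto
          moreover have "closedin (norm_topology A) (F b)"
            using Fc[OF b] by (simp add: closed_ideal_iff)
          ultimately show ?thesis
            unfolding ideal_sup_def by (rule closure_of_minimal)
        qed
        ultimately show ?thesis using sup_R by simp
      qed
    qed
  qed
  then show "(I, J) \<in> R" using g by blast
qed

text \<open>A related pair is a chain indexed by \<open>False < True\<close>.  For \<open>I = J\<close> it is constant.\<close>

lemma subset_transfinite_closure:
  assumes R: "R \<subseteq> closed_ideals A \<times> closed_ideals A" "\<And>I J. (I, J) \<in> R \<Longrightarrow> I \<subseteq> J"
  shows "R \<subseteq> transfinite_closure A R"
proof clarify
  fix I J assume IJ: "(I, J) \<in> R"
  define r where "r = {(x, y). x \<longrightarrow> (y :: bool)}"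
  define F where "F = (\<lambda>b. if b then J else I)"
  have Fr: "Field r = UNIV" by (auto simp: r_def Field_def)
  have "wf (r - Id)"
    by (rule wf_subset[OF wf_measure[of of_bool]]) (auto simp: r_def)
  then have wo: "Well_order r"
    unfolding well_order_on_def order_on_defs Fr
    by (auto simp: r_def refl_on_def trans_def antisym_def total_on_def)
  have under: "underS r False = {}" "underS r True = {False}" "under r False = {False}"
    "under r True = UNIV"
    by (auto simp: underS_def under_def r_def)
  have "transfinite_family A R r F I J"
    unfolding transfinite_family_def Fr
  proof (intro conjI ballI impI)
    show "\<exists>a\<in>UNIV. underS r a = {} \<and> F a = I"
      using under by (intro bexI[of _ False]) (auto simp: F_def)
    show "\<exists>c\<in>UNIV. under r c = UNIV \<and> F c = J"
      using under by (intro bexI[of _ True]) (auto simp: F_def)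
    show "F a \<in> closed_ideals A" for a using IJ R(1) by (auto simp: F_def)
    show "(F a, F b) \<in> R" if "underS r b = under r a" for a b
      using that IJ under by (cases a; cases b) (auto simp: F_def UNIV_bool)
    show "F b = norm_topology A closure_of \<Union> (F ` underS r b)"
      if "underS r b \<noteq> {} \<and> (\<forall>a\<in>UNIV. underS r b \<noteq> under r a)" for b
      using that under by (cases b) auto
  qed (use wo in \<open>simp add: Fr\<close>)
  then show "(I, J) \<in> transfinite_closure A R"
    using transfinite_closureI[OF R(2)] by blast
qed

end

theorem corollary7p16:
  fixes A :: "'a star_algebra"
  assumes "cstar_algebra A"
    and "Group.monoid A"
  shows "R_order A (sm_rel A)
    \<and> sm_rel A = transfinite_closure A (sm_rel A)
    \<and> radical A (sm_rel A) = radical A (transfinite_closure A (sm_rel A))"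
proof -
  interpret unital_cstar_algebra A
    using assms by (simp add: unital_cstar_algebra_def)
  have "sm_rel A = transfinite_closure A (sm_rel A)"
  proof
    show "sm_rel A \<subseteq> transfinite_closure A (sm_rel A)"
      by (rule subset_transfinite_closure) (auto simp: sm_rel_iff)
    show "transfinite_closure A (sm_rel A) \<subseteq> sm_rel A"
      by (rule R_order_transfinite_closure_subset[OF R_order_sm_rel])
  qed
  then show ?thesis using R_order_sm_rel by simp
qed

end
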